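(* Let $a$, $b$, $c$ be positive integers and let $P_{a,b,c}(x,y)$ denote the probability that a uniformly random lozenge tiling of the hexagon with side lengths $a,b,c,a,b,c$ contains the horizontal lozenge with lowest vertex $(x,y)$ (in the oblique coordinate system described in the context). Then the horizontal moment of inertia with respect to the centre $S=\left(\frac{a+b}{2},\frac{a+c}{2}\right)$ of the hexagon is $$\sum_{x=1}^{a+b-1}\sum_{y=0}^{a+c-1} P_{a,b,c}(x,y)\left(x-\frac{a+b}{2}\right)^2=\frac{1}{12}\,ab\,(a^2+b^2-2),$$ and the vertical moment of inertia with respect to $S$ is $$\sum_{y=0}^{a+c-1}\sum_{x=1}^{a+b-1} P_{a,b,c}(x,y)\left(2\left(y-\frac{a+c-1}{2}\right)-\left(x-\frac{a+b}{2}\right)\right)^2=\frac{1}{12}\,ab\,(a^2+b^2-2+4c^2+4ac+4bc).$$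
   Context: Oblique coordinates: the point with oblique coordinates $(x,y)$ is the point $x e_1+y e_2$ of the Euclidean plane, where $e_1=(\sqrt3/2,-1/2)$ and $e_2=(0,1)$ are unit vectors. The hexagon with side lengths $a,b,c,a,b,c$ (all angles $120^\circ$) is the one whose vertices in oblique coordinates are $(0,0)$, $(b,0)$, $(a+b,a)$, $(a+b,a+c)$, $(a,a+c)$, $(0,c)$; thus the origin is a vertex where a side of length $b$ and a side of length $c$ meet, the axes run along these two sides, and the hexagon is subdivided into unit equilateral triangles of the triangular lattice generated by $e_1,e_2$. A lozenge is the union of two such unit triangles sharing an edge (a rhombus with all sides of length $1$ and angles $60^\circ$ and $120^\circ$); a lozenge tiling of the hexagon is a covering of the hexagon by lozenges with pairwise disjoint interiors. The horizontal lozenge with lowest vertex $(x,y)$ ($x,y$ integers) is the lozenge with vertices $(x,y)$, $(x+1,y+1)$, $(x,y+1)$, $(x-1,y)$ in oblique coordinates. $P_{a,b,c}(x,y)$ is the number of lozenge tilings of the hexagon containing this lozenge divided by the total number of lozenge tilings of the hexagon (so it is $0$ if this lozenge is not contained in the hexagon). *)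

theory Defs
  imports "HOL-Analysis.Analysis"
begin

definition e1 :: "real \<times> real" where
  "e1 = (sqrt 3 / 2, - 1 / 2)"

definition e2 :: "real \<times> real" where
  "e2 = (0, 1)"

definition oblique :: "real \<Rightarrow> real \<Rightarrow> real \<times> real" where
  "oblique x y = x *\<^sub>R e1 + y *\<^sub>R e2"

definition lattice_points :: "(real \<times> real) set" where
  "lattice_points = {oblique (of_int i) (of_int j) | i j. True}"

text \<open>The distance on \<^typ>\<open>real \<times> real\<close> is the Euclidean one.\<close>

definition unit_triangle :: "real \<times> real \<Rightarrow> real \<times> real \<Rightarrow> real \<times> real \<Rightarrow> bool" where
  "unit_triangle p q r \<longleftrightarrow> {p, q, r} \<subseteq> lattice_points \<and>
     dist p q = 1 \<and> dist q r = 1 \<and> dist r p = 1"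

text \<open>The two triangles share the edge from \<open>p\<close> to \<open>q\<close>.\<close>

definition lozenges :: "(real \<times> real) set set" where
  "lozenges = {convex hull {p, q, r} \<union> convex hull {p, q, s} | p q r s.
     unit_triangle p q r \<and> unit_triangle p q s \<and> r \<noteq> s}"

definition hexagon :: "nat \<Rightarrow> nat \<Rightarrow> nat \<Rightarrow> (real \<times> real) set" where
  "hexagon a b c = convex hull
     {oblique 0 0, oblique (real b) 0, oblique (real (a + b)) (real a),
      oblique (real (a + b)) (real (a + c)), oblique (real a) (real (a + c)),
      oblique 0 (real c)}"

definition lozenge_tilings :: "nat \<Rightarrow> nat \<Rightarrow> nat \<Rightarrow> (real \<times> real) set set set" where
  "lozenge_tilings a b c = {T. T \<subseteq> lozenges \<and> \<Union>T = hexagon a b c \<and>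
     pairwise (\<lambda>s t. interior s \<inter> interior t = {}) T}"

definition horizontal_lozenge :: "int \<Rightarrow> int \<Rightarrow> (real \<times> real) set" where
  "horizontal_lozenge x y = convex hull
     {oblique (of_int x) (of_int y), oblique (of_int (x + 1)) (of_int (y + 1)),
      oblique (of_int x) (of_int (y + 1)), oblique (of_int (x - 1)) (of_int y)}"

definition lozenge_prob :: "nat \<Rightarrow> nat \<Rightarrow> nat \<Rightarrow> int \<Rightarrow> int \<Rightarrow> real" where
  "lozenge_prob a b c x y =
     real (card {T \<in> lozenge_tilings a b c. horizontal_lozenge x y \<in> T}) /
     real (card (lozenge_tilings a b c))"

end

theory Submission
  imports Defs "Jordan_Normal_Form.Determinant"
begin

text \<open>
  Cut a tiling along the vertical lines \<open>x = i\<close>. On line \<open>i\<close> the horizontal lozenges occupy some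
  of the unit edges; add the positions \<open>j < i - b\<close> below and \<open>a + c \<le> j < c + i\<close> above the hexagon,
  as if these corners were filled with horizontal lozenges too. Then line \<open>i\<close> carries exactly \<open>i\<close>
  positions in \<open>[0, c + i)\<close>, the positions on consecutive lines interlace, and the last
  line \<open>i = a + b\<close> has the fixed positions \<open>0, ..., a - 1, a + c, ..., a + b + c - 1\<close>. So tilings are the
  Gelfand-Tsetlin patterns with this top row (\<open>bij_betw_gt_patterns_matchings\<close> together
  with \<open>bij_betw_matchings_tilings\<close>), and both moments are sums over the lines of expected power
  sums of degree at most 2 of a row, corrected by an explicit sum over the added positions
  (\<open>sum_lozenge_prob\<close>).

  The expected power sums come from martingales. For columns \<open>s\<^sub>0, ..., s\<^sub>k\<^sub>-\<^sub>1\<close> consider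
  \<open>det (binomial (l\<^sub>i, s\<^sub>j))\<close>. Summing over all rows that interlace with \<open>l\<close> acts on each column as an
  antidifference, and the antidifference of \<open>binomial (x, s)\<close> is \<open>binomial (x, s + 1)\<close>; so the sum is the
  determinant of the next size with columns \<open>0, s\<^sub>0 + 1, ..., s\<^sub>k\<^sub>-\<^sub>1 + 1\<close> (\<open>sum_interlacing_alternant\<close>).
  In particular the determinant with columns \<open>0, ..., n - 1\<close> counts the patterns with top row \<open>l\<close>, and
  the quotients by it of the determinants with columns \<open>0, ..., n - 2, n\<close>, with columns
  \<open>0, ..., n - 2, n + 1\<close> and with columns \<open>0, ..., n - 3, n - 1, n\<close> have the same expectation on every
  line that has enough columns. The power sums of degree 1 and 2 of a row of length \<open>k\<close> are linear combinations of
  1 and these quotients, with coefficients that depend on \<open>k\<close> only (\<open>power_sum_1_vandermonde\<close>, \<open>power_sum_2_vandermonde\<close>). The three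
  constant expectations are read off from the top row (\<open>top_row_alternants\<close>), which makes the
  expected power sums on line \<open>i\<close> explicit polynomials in \<open>i\<close> (\<open>row_means\<close>); what remains is a summation of
  polynomials.

  The passage from coverings of a region of the plane to patterns has two steps. Points on no lattice
  line lie in exactly one unit triangle, and such points are dense, so a tiling amounts to a perfect
  matching of the unit triangles in the hexagon. For a matching, the number of horizontal lozenges
  below a lattice point on its vertical line is a height function: along a vertical or an
  \<open>e1\<close>-edge it grows by 1 if a lozenge straddles the edge and by 0 otherwise, and along an
  \<open>e1 + e2\<close>-edge it is the other way round. These local rules are equivalent to interlacing.
\<close>

section \<open>Alternants of binomial coefficients\<close>

definition alternant :: "nat \<Rightarrow> (nat \<Rightarrow> nat \<Rightarrow> real) \<Rightarrow> (nat \<Rightarrow> nat) \<Rightarrow> real" where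
  "alternant k \<phi> l = Determinant.det (Matrix.mat k k (\<lambda>(i, j). \<phi> j (l i)))"

lemma alternant_rows:
  "alternant k \<phi> l = (\<Sum>p | p permutes {0..<k}. of_int (sign p) * (\<Prod>i<k. \<phi> (p i) (l i)))"
proof -
  have "(\<Prod>i = 0..<k. Matrix.mat k k (\<lambda>(i, j). \<phi> j (l i)) $$ (i, p i)) = (\<Prod>i<k. \<phi> (p i) (l i))"
    if "p permutes {0..<k}" for p
    unfolding lessThan_atLeast0
    by (rule prod.cong) (use permutes_in_image[OF that] in auto)
  then show ?thesis by (simp add: alternant_def Determinant.det_def)
qed

lemma alternant_columns:
  "alternant k \<phi> l = (\<Sum>p | p permutes {0..<k}. of_int (sign p) * (\<Prod>j<k. \<phi> j (l (p j))))"
proof -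
  have "(\<Prod>j<k. Matrix.mat k k (\<lambda>(i, j). \<phi> j (l i)) $$ (p j, j)) = (\<Prod>j<k. \<phi> j (l (p j)))"
    if "p permutes {0..<k}" for p
    by (rule prod.cong) (use permutes_in_image[OF that] in auto)
  then show ?thesis by (simp add: alternant_def det_col[of _ k])
qed

lemma alternant_cong:
  assumes "\<And>j. j < k \<Longrightarrow> \<phi> j = \<psi> j"
  shows "alternant k \<phi> l = alternant k \<psi> l"
  unfolding alternant_rows
  by (intro sum.cong refl arg_cong2[where f="(*)"] prod.cong)
     (use assms in \<open>auto dest: permutes_in_image\<close>)

text \<open>Only the factor of column \<open>j\<close> in each Leibniz summand changes.\<close>

lemma alternant_linear:
  assumes "j < k"
  shows "alternant k (\<phi>(j := \<lambda>x. \<alpha> * u x + \<beta> * v x)) l =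
    \<alpha> * alternant k (\<phi>(j := u)) l + \<beta> * alternant k (\<phi>(j := v)) l"
proof -
  have split: "(\<Prod>i<k. (\<phi>(j := w)) i (l (p i))) = w (l (p j)) * (\<Prod>i\<in>{..<k} - {j}. \<phi> i (l (p i)))" for w p
    using assms by (subst prod.remove[of _ j]) (auto intro!: prod.cong)
  show ?thesis
    unfolding alternant_columns split sum_distrib_left sum.distrib[symmetric]
    by (simp add: algebra_simps)
qed

lemma alternant_repeated_column:
  assumes "i < k" "j < k" "i \<noteq> j" "\<phi> i = \<phi> j"
  shows "alternant k \<phi> l = 0"
  unfolding alternant_def
  by (rule det_identical_columns[where n=k and i=i and j=j]) (use assms in auto)

lemma alternant_swap_columns:
  assumes "i < k" "j < k" "i \<noteq> j"
  shows "alternant k (\<phi>(i := \<phi> j, j := \<phi> i)) l = - alternant k \<phi> l"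
proof -
  have "swapcols i j (Matrix.mat k k (\<lambda>(r, s). \<phi> s (l r))) =
      Matrix.mat k k (\<lambda>(r, s). (\<phi>(i := \<phi> j, j := \<phi> i)) s (l r))"
    by (rule eq_matI) (use assms in auto)
  then show ?thesis
    unfolding alternant_def using det_swapcols[OF assms] by (metis mat_carrier)
qed

text \<open>Weighting row \<open>i\<close> by \<open>w (l i)\<close> and summing over the rows, or weighting column \<open>j\<close> entrywise and summing
  over the columns, multiplies every Leibniz summand by the same total weight. This is how multiplication by a
  power sum is turned into a sum of alternants.\<close>

lemma sum_weights_alternant:
  "(\<Sum>i<k. w (l i)) * alternant k \<phi> l = (\<Sum>j<k. alternant k (\<phi>(j := \<lambda>x. w x * \<phi> j x)) l)"
proof -
  have split: "(\<Prod>i<k. (\<phi>(j := \<lambda>x. w x * \<phi> j x)) i (l (p i))) = w (l (p j)) * (\<Prod>i<k. \<phi> i (l (p i)))"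
    if "j < k" for j p
  proof -
    have "(\<Prod>i<k. (\<phi>(j := \<lambda>x. w x * \<phi> j x)) i (l (p i))) =
        (w (l (p j)) * \<phi> j (l (p j))) * (\<Prod>i\<in>{..<k} - {j}. \<phi> i (l (p i)))"
      using that by (subst prod.remove[of _ j]) (auto intro!: prod.cong)
    also have "\<dots> = w (l (p j)) * (\<Prod>i<k. \<phi> i (l (p i)))"
      using that by (subst (2) prod.remove[of _ j]) auto
    finally show ?thesis .
  qed
  have perm: "(\<Sum>j<k. w (l (p j))) = (\<Sum>j<k. w (l j))" if "p permutes {0..<k}" for p
    using sum.permute[OF that, of "\<lambda>j. w (l j)"] by (simp add: lessThan_atLeast0 o_def)
  have "(\<Sum>j<k. alternant k (\<phi>(j := \<lambda>x. w x * \<phi> j x)) l) =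
      (\<Sum>j<k. \<Sum>p | p permutes {0..<k}. of_int (sign p) * (w (l (p j)) * (\<Prod>i<k. \<phi> i (l (p i)))))"
    unfolding alternant_columns
    by (intro sum.cong refl arg_cong2[where f="(*)"]) (auto simp: split simp del: fun_upd_apply)
  also have "\<dots> = (\<Sum>p | p permutes {0..<k}. (\<Sum>j<k. w (l (p j))) * (of_int (sign p) * (\<Prod>i<k. \<phi> i (l (p i)))))"
    by (subst sum.swap) (simp add: sum_distrib_right sum_distrib_left mult_ac)
  also have "\<dots> = (\<Sum>i<k. w (l i)) * alternant k \<phi> l"
    unfolding alternant_columns sum_distrib_left by (intro sum.cong refl) (simp add: perm)
  finally show ?thesis by simp
qed

text \<open>The shorter row is \<open>undefined\<close> outside its length, so that rows can be counted.\<close>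

definition interlacing :: "nat \<Rightarrow> (nat \<Rightarrow> nat) \<Rightarrow> (nat \<Rightarrow> nat) set" where
  "interlacing k l = PiE {..<k} (\<lambda>i. {l i..<l (Suc i)})"

lemma finite_interlacing: "finite (interlacing k l)"
  unfolding interlacing_def by (rule finite_PiE) auto

text \<open>Multiply by the unipotent matrix that subtracts from each row its predecessor, then expand along the first
  column, which has become a unit vector.\<close>

lemma det_first_differences:
  fixes f :: "nat \<Rightarrow> nat \<Rightarrow> real"
  assumes one: "\<And>i. f i 0 = 1"
  shows "Determinant.det (Matrix.mat (Suc k) (Suc k) (\<lambda>(i, j). f i j)) =
    Determinant.det (Matrix.mat k k (\<lambda>(i, j). f (Suc i) (Suc j) - f i (Suc j)))"
proof -
  let ?A = "Matrix.mat (Suc k) (Suc k) (\<lambda>(i, j). f i j)"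
  let ?L = "Matrix.mat (Suc k) (Suc k) (\<lambda>(i, j). if i = j then 1 else if i = Suc j then - 1 else (0::real))"
  let ?D = "Matrix.mat (Suc k) (Suc k) (\<lambda>(i, j). f i j - (if i = 0 then 0 else f (i - 1) j))"
  let ?E = "Matrix.mat k k (\<lambda>(i, j). f (Suc i) (Suc j) - f i (Suc j))"
  have "Determinant.det ?L = prod_list (diag_mat ?L)"
    by (rule det_lower_triangular[where n="Suc k"]) auto
  also have "diag_mat ?L = map (\<lambda>i. 1) [0..<Suc k]"
    unfolding diag_mat_def by (rule map_cong) auto
  finally have L: "Determinant.det ?L = 1" by (simp add: map_replicate_const del: upt_Suc)
  have LA: "?L * ?A = ?D"
  proof (rule eq_matI)
    fix i j assume "i < dim_row ?D" "j < dim_col ?D"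
    then have ij: "i < Suc k" "j < Suc k" by auto
    have "(?L * ?A) $$ (i, j) = (\<Sum>t<Suc k. (if i = t then 1 else if i = Suc t then - 1 else 0) * f t j)"
      using ij by (auto simp: scalar_prod_def lessThan_atLeast0 simp del: sum.op_ivl_Suc intro!: sum.cong)
    also have "\<dots> = (\<Sum>t<Suc k. (if t = i then f t j else 0) - (if i \<noteq> 0 \<and> t = i - 1 then f t j else 0))"
      by (rule sum.cong) auto
    also have "\<dots> = f i j - (if i = 0 then 0 else f (i - 1) j)"
      unfolding sum_subtractf using ij by (cases "i = 0") (auto simp: sum.delta simp del: sum.lessThan_Suc)
    finally show "(?L * ?A) $$ (i, j) = ?D $$ (i, j)" using ij by simp
  qed auto
  have "Determinant.det ?A = Determinant.det ?L * Determinant.det ?A" by (simp add: L)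
  also have "\<dots> = Determinant.det ?D"
    unfolding LA[symmetric] by (rule det_mult[symmetric, where n="Suc k"]) auto
  also have "\<dots> = (\<Sum>i<Suc k. ?D $$ (i, 0) * cofactor ?D i 0)"
    by (rule laplace_expansion_column) auto
  also have "\<dots> = (\<Sum>i<Suc k. if i = 0 then cofactor ?D 0 0 else 0)"
    by (rule sum.cong) (auto simp: one)
  also have "\<dots> = Determinant.det (mat_delete ?D 0 0)"
    by (simp add: cofactor_def sum.delta del: sum.lessThan_Suc)
  also have "mat_delete ?D 0 0 = ?E"
    by (rule eq_matI) (auto simp: mat_delete_def)
  finally show ?thesis .
qed

definition bin :: "nat \<Rightarrow> nat \<Rightarrow> real" where
  "bin n x = real (x choose n)"

lemma sum_bin: "p \<le> q \<Longrightarrow> (\<Sum>x\<in>{p..<q}. bin n x) = bin (Suc n) q - bin (Suc n) p"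
  by (induction q rule: nat_induct_at_least) (auto simp: bin_def)

text \<open>The entries of an interlacing row range over consecutive intervals independently, so the sum may be taken
  inside each row of the determinant, where it telescopes. The result is a determinant of first
  differences.\<close>

lemma sum_interlacing_alternant:
  assumes l: "strict_mono_on {..<Suc k} l"
    and \<phi>: "\<And>j. j < k \<Longrightarrow> \<phi> j = bin (s j)"
    and \<psi>: "\<psi> 0 = bin 0" "\<And>j. j < k \<Longrightarrow> \<psi> (Suc j) = bin (Suc (s j))"
  shows "(\<Sum>m\<in>interlacing k l. alternant k \<phi> m) = alternant (Suc k) \<psi> l"
proof -
  have mono: "l i \<le> l (Suc i)" if "i < k" for i
    using strict_mono_onD[OF l, of i "Suc i"] that by simp
  have "(\<Sum>m\<in>interlacing k l. alternant k \<phi> m) = (\<Sum>m\<in>interlacing k l. alternant k (\<lambda>j. bin (s j)) m)"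
    by (intro sum.cong refl alternant_cong \<phi>)
  also have "\<dots> =
      (\<Sum>p | p permutes {0..<k}. of_int (sign p) * (\<Sum>m\<in>interlacing k l. \<Prod>i<k. bin (s (p i)) (m i)))"
    unfolding alternant_rows by (subst sum.swap) (simp add: sum_distrib_left)
  also have "\<dots> = (\<Sum>p | p permutes {0..<k}. of_int (sign p) *
      (\<Prod>i<k. bin (Suc (s (p i))) (l (Suc i)) - bin (Suc (s (p i))) (l i)))"
    unfolding interlacing_def
    by (intro sum.cong refl arg_cong2[where f="(*)"], subst prod_sum_PiE[symmetric])
       (auto intro!: prod.cong simp: sum_bin mono)
  also have "\<dots> = Determinant.det (Matrix.mat k k (\<lambda>(i, j). bin (Suc (s j)) (l (Suc i)) - bin (Suc (s j)) (l i)))"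
    by (subst Determinant.det_def)
       (auto intro!: sum.cong prod.cong simp: lessThan_atLeast0 dest: permutes_in_image)
  also have "\<dots> = Determinant.det (Matrix.mat k k (\<lambda>(i, j). \<psi> (Suc j) (l (Suc i)) - \<psi> (Suc j) (l i)))"
    by (rule arg_cong[where f=Determinant.det], rule eq_matI) (auto simp: \<psi>(2))
  also have "\<dots> = alternant (Suc k) \<psi> l"
    unfolding alternant_def
    by (rule det_first_differences[symmetric]) (simp add: \<psi>(1) bin_def)
  finally show ?thesis .
qed

text \<open>Up to the constant \<open>\<Prod>j<k. fact j\<close> this is the Vandermonde determinant, because the columns
  \<open>bin j\<close> have degree \<open>j\<close>. The three variants below are, likewise up to lower order terms, the
  alternants of the partitions (1), (2) and (1, 1): the largest exponents are raised by the parts.\<close>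

definition vandermonde :: "nat \<Rightarrow> (nat \<Rightarrow> nat) \<Rightarrow> real" where
  "vandermonde k = alternant k bin"

definition alternant_1 :: "nat \<Rightarrow> (nat \<Rightarrow> nat) \<Rightarrow> real" where
  "alternant_1 k = alternant k (bin(k - 1 := bin k))"

definition alternant_2 :: "nat \<Rightarrow> (nat \<Rightarrow> nat) \<Rightarrow> real" where
  "alternant_2 k = alternant k (bin(k - 1 := bin (k + 1)))"

definition alternant_11 :: "nat \<Rightarrow> (nat \<Rightarrow> nat) \<Rightarrow> real" where
  "alternant_11 k = alternant k (bin(k - 2 := bin (k - 1), k - 1 := bin k))"

lemma sum_interlacing_vandermonde:
  assumes "strict_mono_on {..<Suc k} l"
  shows "(\<Sum>m\<in>interlacing k l. vandermonde k m) = vandermonde (Suc k) l"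
  unfolding vandermonde_def
  by (rule sum_interlacing_alternant[OF assms, where s="\<lambda>j. j"]) auto

lemma sum_interlacing_alternant_1:
  assumes "strict_mono_on {..<Suc k} l" and "k \<ge> 1"
  shows "(\<Sum>m\<in>interlacing k l. alternant_1 k m) = alternant_1 (Suc k) l"
  unfolding alternant_1_def
  by (rule sum_interlacing_alternant[OF assms(1), where s="id(k - 1 := k)"]) (use assms(2) in auto)

lemma sum_interlacing_alternant_2:
  assumes "strict_mono_on {..<Suc k} l" and "k \<ge> 1"
  shows "(\<Sum>m\<in>interlacing k l. alternant_2 k m) = alternant_2 (Suc k) l"
  unfolding alternant_2_def
  by (rule sum_interlacing_alternant[OF assms(1), where s="id(k - 1 := k + 1)"]) (use assms(2) in auto)

lemma sum_interlacing_alternant_11: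
  assumes "strict_mono_on {..<Suc k} l" and "k \<ge> 2"
  shows "(\<Sum>m\<in>interlacing k l. alternant_11 k m) = alternant_11 (Suc k) l"
  unfolding alternant_11_def
  by (rule sum_interlacing_alternant[OF assms(1), where s="id(k - 2 := k - 1, k - 1 := k)"]) (use assms(2) in auto)

lemma sum_power_1: "(\<Sum>i<n. real i) = real n * (real n - 1) / 2"
  and sum_power_2: "(\<Sum>i<n. (real i)\<^sup>2) = real n * (real n - 1) * (2 * real n - 1) / 6"
  and sum_power_3: "(\<Sum>i<n. (real i) ^ 3) = (real n * (real n - 1))\<^sup>2 / 4"
  by (induction n) (simp_all add: field_simps power2_eq_square power3_eq_cube)

lemma mult_bin: "real x * bin n x = real (n + 1) * bin (n + 1) x + real n * bin n x"
proof -
  have "Suc n * (x choose Suc n) + n * (x choose n) = x * (x choose n)"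
  proof (cases "n \<le> x")
    case True
    have "Suc n * (x choose Suc n) = (x - n) * (x choose n)"
      by (simp only: binomial_absorption binomial_absorb_comp)
    then show ?thesis
      using True by (simp only: add_mult_distrib[symmetric] le_add_diff_inverse2)
  qed (simp add: binomial_eq_0)
  then have "real (Suc n * (x choose Suc n) + n * (x choose n)) = real (x * (x choose n))"
    by (simp only:)
  then show ?thesis by (simp add: bin_def algebra_simps)
qed

lemma square_mult_bin:
  "(real x)\<^sup>2 * bin n x = real ((n + 1) * (n + 2)) * bin (n + 2) x +
    (real ((n + 1) * (2 * n + 1)) * bin (n + 1) x + (real n)\<^sup>2 * bin n x)"
proof -
  have "(real x)\<^sup>2 * bin n x = real (n + 1) * (real x * bin (n + 1) x) + real n * (real x * bin n x)"
    using mult_bin[of x n] by (simp add: power2_eq_square algebra_simps)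
  then show ?thesis
    unfolding mult_bin[of x n] mult_bin[of x "n + 1"] by (simp add: power2_eq_square algebra_simps)
qed

lemma alternant_mult_bin:
  assumes "j < k"
  shows "alternant k (\<phi>(j := \<lambda>x. real x * bin n x)) l =
    real (n + 1) * alternant k (\<phi>(j := bin (n + 1))) l + real n * alternant k (\<phi>(j := bin n)) l"
  using alternant_linear[OF assms, of \<phi> "real (n + 1)" "bin (n + 1)" "real n" "bin n" l]
  by (simp only: mult_bin)

lemma alternant_square_mult_bin:
  assumes "j < k"
  shows "alternant k (\<phi>(j := \<lambda>x. (real x)\<^sup>2 * bin n x)) l =
    real ((n + 1) * (n + 2)) * alternant k (\<phi>(j := bin (n + 2))) l +
    real ((n + 1) * (2 * n + 1)) * alternant k (\<phi>(j := bin (n + 1))) l +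
    (real n)\<^sup>2 * alternant k (\<phi>(j := bin n)) l"
proof -
  let ?v = "\<lambda>x. real ((n + 1) * (2 * n + 1)) * bin (n + 1) x + (real n)\<^sup>2 * bin n x"
  have "alternant k (\<phi>(j := \<lambda>x. (real x)\<^sup>2 * bin n x)) l =
    real ((n + 1) * (n + 2)) * alternant k (\<phi>(j := bin (n + 2))) l + 1 * alternant k (\<phi>(j := ?v)) l"
    using alternant_linear[OF assms, of \<phi> "real ((n + 1) * (n + 2))" "bin (n + 2)" 1 ?v l]
    by (simp only: square_mult_bin mult_1)
  also have "alternant k (\<phi>(j := ?v)) l = real ((n + 1) * (2 * n + 1)) * alternant k (\<phi>(j := bin (n + 1))) l +
    (real n)\<^sup>2 * alternant k (\<phi>(j := bin n)) l"
    by (rule alternant_linear[OF assms])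
  finally show ?thesis by (simp only: mult_1 add.assoc)
qed

text \<open>Multiplication by \<open>x\<close> turns column \<open>j\<close> into a combination of columns \<open>j\<close> and \<open>j + 1\<close>; a raised column
  repeats its neighbour, and so gives zero, unless it is the last one.\<close>

lemma power_sum_1_vandermonde:
  "(\<Sum>i<k. real (l i)) * vandermonde k l = real k * alternant_1 k l + real k * (real k - 1) / 2 * vandermonde k l"
proof (cases k)
  case (Suc n)
  have "(\<Sum>i<k. real (l i)) * vandermonde k l =
     (\<Sum>j<k. alternant k (bin(j := \<lambda>x. real x * bin j x)) l)"
    unfolding vandermonde_def by (rule sum_weights_alternant[of "\<lambda>x. real x"])
  also have "\<dots> = (\<Sum>j<k. real (j + 1) * alternant k (bin(j := bin (j + 1))) l + real j * vandermonde k l)"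
    by (intro sum.cong refl) (simp add: alternant_mult_bin vandermonde_def)
  also have "\<dots> = (\<Sum>j<k. real (j + 1) * alternant k (bin(j := bin (j + 1))) l) + real k * (real k - 1) / 2 * vandermonde k l"
    by (simp add: sum.distrib sum_power_1 flip: sum_distrib_right)
  also have "(\<Sum>j<k. real (j + 1) * alternant k (bin(j := bin (j + 1))) l) =
      (\<Sum>j<k. if j = n then real k * alternant_1 k l else 0)"
  proof (rule sum.cong)
    fix j assume j: "j \<in> {..<k}"
    show "real (j + 1) * alternant k (bin(j := bin (j + 1))) l = (if j = n then real k * alternant_1 k l else 0)"
    proof (cases "j = n")
      case False
      then have "alternant k (bin(j := bin (j + 1))) l = 0"
        using j Suc by (intro alternant_repeated_column[of j _ "j + 1"]) auto
      with False show ?thesis by simp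
    qed (simp add: alternant_1_def Suc)
  qed simp
  finally show ?thesis by (simp add: Suc sum.delta)
qed (simp add: vandermonde_def)

text \<open>Both the last column and the last but one can be raised here, since there is a gap above the latter.\<close>

lemma power_sum_1_alternant_1:
  assumes "k \<ge> 2"
  shows "(\<Sum>i<k. real (l i)) * alternant_1 k l =
    real (k + 1) * alternant_2 k l + real (k - 1) * alternant_11 k l
    + (real k + (real k - 1) * (real k - 2) / 2) * alternant_1 k l"
proof -
  define n where "n = k - 1"
  define \<phi> where "\<phi> = bin(n := bin k)"
  have k: "k = Suc n" "n \<ge> 1" using assms by (auto simp: n_def)
  have a1: "alternant_1 k l = alternant k \<phi> l" by (simp add: alternant_1_def \<phi>_def n_def)
  have "(\<Sum>i<k. real (l i)) * alternant_1 k l = (\<Sum>j<k. alternant k (\<phi>(j := \<lambda>x. real x * \<phi> j x)) l)"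
    unfolding a1 by (rule sum_weights_alternant[of "\<lambda>x. real x"])
  also have "\<dots> = (\<Sum>j<n. alternant k (\<phi>(j := \<lambda>x. real x * bin j x)) l) + alternant k (\<phi>(n := \<lambda>x. real x * bin k x)) l"
    by (simp add: k(1) \<phi>_def del: fun_upd_apply) (auto intro!: sum.cong)
  also have "alternant k (\<phi>(n := \<lambda>x. real x * bin k x)) l = real (k + 1) * alternant_2 k l + real k * alternant_1 k l"
    unfolding a1 by (subst alternant_mult_bin) (auto simp: k(1) alternant_2_def \<phi>_def)
  also have "(\<Sum>j<n. alternant k (\<phi>(j := \<lambda>x. real x * bin j x)) l) =
      (\<Sum>j<n. real (j + 1) * alternant k (\<phi>(j := bin (j + 1))) l + real j * alternant_1 k l)"
  proof (rule sum.cong)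
    fix j assume j: "j \<in> {..<n}"
    then have jk: "j < k" and eq: "\<phi>(j := bin j) = \<phi>" by (auto simp: \<phi>_def k(1))
    show "alternant k (\<phi>(j := \<lambda>x. real x * bin j x)) l =
        real (j + 1) * alternant k (\<phi>(j := bin (j + 1))) l + real j * alternant_1 k l"
      by (simp only: alternant_mult_bin[OF jk] eq a1)
  qed simp
  also have "\<dots> = (\<Sum>j<n. real (j + 1) * alternant k (\<phi>(j := bin (j + 1))) l) + real n * (real n - 1) / 2 * alternant_1 k l"
    by (simp add: sum.distrib sum_power_1 flip: sum_distrib_right)
  also have "(\<Sum>j<n. real (j + 1) * alternant k (\<phi>(j := bin (j + 1))) l) =
      (\<Sum>j<n. if j = n - 1 then real n * alternant_11 k l else 0)"
  proof (rule sum.cong)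
    fix j assume j: "j \<in> {..<n}"
    show "real (j + 1) * alternant k (\<phi>(j := bin (j + 1))) l = (if j = n - 1 then real n * alternant_11 k l else 0)"
    proof (cases "j = n - 1")
      case True
      then have "\<phi>(j := bin (j + 1)) = bin(k - 2 := bin (k - 1), k - 1 := bin k)"
        using k by (auto simp: \<phi>_def fun_eq_iff)
      then show ?thesis using True k by (simp add: alternant_11_def)
    next
      case False
      then have "alternant k (\<phi>(j := bin (j + 1))) l = 0"
        using j k by (intro alternant_repeated_column[of j _ "j + 1"]) (auto simp: \<phi>_def)
      with False show ?thesis by simp
    qed
  qed simp
  also have "\<dots> = real n * alternant_11 k l" using k by (simp add: sum.delta)
  finally show ?thesis using k by (simp add: algebra_simps)
qed

text \<open>Multiplication by \<open>x\<^sup>2\<close> raises a column by at most two. Raising by one survives for the last column, raising by two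
  for the last column and the last but one; in the latter case the two last columns are out of order, which
  accounts for the minus sign.\<close>

lemma power_sum_2_vandermonde:
  assumes "k \<ge> 1"
  shows "(\<Sum>i<k. (real (l i))\<^sup>2) * vandermonde k l =
    real k * (real k + 1) * alternant_2 k l - real k * (real k - 1) * alternant_11 k l
    + real k * (2 * real k - 1) * alternant_1 k l + (\<Sum>j<k. (real j)\<^sup>2) * vandermonde k l"
proof -
  define n where "n = k - 1"
  have k: "k = Suc n" using assms by (auto simp: n_def)
  have "(\<Sum>i<k. (real (l i))\<^sup>2) * vandermonde k l =
     (\<Sum>j<k. alternant k (bin(j := \<lambda>x. (real x)\<^sup>2 * bin j x)) l)"
    unfolding vandermonde_def by (rule sum_weights_alternant[of "\<lambda>x. (real x)\<^sup>2"])
  also have "\<dots> = (\<Sum>j<k. real ((j + 1) * (j + 2)) * alternant k (bin(j := bin (j + 2))) l +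
     real ((j + 1) * (2 * j + 1)) * alternant k (bin(j := bin (j + 1))) l + (real j)\<^sup>2 * vandermonde k l)"
    by (intro sum.cong refl) (simp add: alternant_square_mult_bin vandermonde_def)
  also have "\<dots> = (\<Sum>j<n. real ((j + 1) * (j + 2)) * alternant k (bin(j := bin (j + 2))) l)
     + (\<Sum>j<n. real ((j + 1) * (2 * j + 1)) * alternant k (bin(j := bin (j + 1))) l)
     + real k * (real k + 1) * alternant_2 k l + real k * (2 * real k - 1) * alternant_1 k l
     + (\<Sum>j<k. (real j)\<^sup>2) * vandermonde k l"
    unfolding sum.distrib sum_distrib_right
    by (simp add: k alternant_1_def alternant_2_def algebra_simps)
  also have "(\<Sum>j<n. real ((j + 1) * (2 * j + 1)) * alternant k (bin(j := bin (j + 1))) l) = 0"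
  proof (rule sum.neutral, rule ballI)
    fix j assume j: "j \<in> {..<n}"
    then have "alternant k (bin(j := bin (j + 1))) l = 0"
      using k by (intro alternant_repeated_column[of j _ "j + 1"]) auto
    then show "real ((j + 1) * (2 * j + 1)) * alternant k (bin(j := bin (j + 1))) l = 0" by simp
  qed
  also have "(\<Sum>j<n. real ((j + 1) * (j + 2)) * alternant k (bin(j := bin (j + 2))) l) =
      (\<Sum>j<n. if j = n - 1 then - real n * (real n + 1) * alternant_11 k l else 0)"
  proof (rule sum.cong)
    fix j assume j: "j \<in> {..<n}"
    show "real ((j + 1) * (j + 2)) * alternant k (bin(j := bin (j + 2))) l =
        (if j = n - 1 then - real n * (real n + 1) * alternant_11 k l else 0)"
    proof (cases "j = n - 1")
      case True
      let ?\<phi> = "bin(j := bin (j + 2))"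
      have "bin(k - 2 := bin (k - 1), k - 1 := bin k) = ?\<phi>(j := ?\<phi> n, n := ?\<phi> j)"
        using True j k by (auto simp: fun_eq_iff)
      then have "alternant_11 k l = - alternant k ?\<phi> l"
        unfolding alternant_11_def using j k by (simp only: alternant_swap_columns lessThan_iff)
      then show ?thesis using True j by (simp add: algebra_simps)
    next
      case False
      then have "alternant k (bin(j := bin (j + 2))) l = 0"
        using j k by (intro alternant_repeated_column[of j _ "j + 2"]) auto
      with False show ?thesis by simp
    qed
  qed simp
  also have "\<dots> = - real n * (real n + 1) * alternant_11 k l" by (cases n) (simp_all add: sum.delta)
  finally show ?thesis by (simp add: k algebra_simps)
qed

section \<open>Gelfand-Tsetlin patterns\<close>

lemma strict_mono_interlacing:
  assumes l: "strict_mono_on {..<Suc n} l" and m: "m \<in> interlacing n l"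
  shows "strict_mono_on {..<n} m"
proof (rule strict_mono_onI)
  fix i j assume ij: "i \<in> {..<n}" "j \<in> {..<n}" "i < j"
  have "m i < l (Suc i)" "l j \<le> m j" using m ij by (auto simp: interlacing_def PiE_iff)
  moreover have "l (Suc i) \<le> l j"
    using strict_mono_on_imp_mono_on[OF l] ij by (auto simp: monotone_on_def)
  ultimately show "m i < m j" by simp
qed

text \<open>The entry \<open>k\<close> of row \<open>i\<close> is \<open>p i k\<close>; row \<open>i\<close> has \<open>i\<close> entries and the bottom row is empty. Everything outside
  the pattern is \<open>undefined\<close>, so that the set is finite.\<close>

definition gt_patterns :: "nat \<Rightarrow> (nat \<Rightarrow> nat) \<Rightarrow> (nat \<Rightarrow> nat \<Rightarrow> nat) set" where
  "gt_patterns n l = {p. p n = l \<and> (\<forall>i<n. p i \<in> interlacing i (p (Suc i))) \<and> (\<forall>i>n. p i = undefined)}"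

lemma gt_patterns_0: "gt_patterns 0 l = {(\<lambda>i. undefined)(0 := l)}"
  by (auto simp: gt_patterns_def fun_eq_iff)

lemma gt_patterns_Suc:
  "gt_patterns (Suc n) l = (\<Union>m\<in>interlacing n l. (\<lambda>p. p(Suc n := l)) ` gt_patterns n m)"
proof (intro equalityI subsetI)
  fix p assume p: "p \<in> gt_patterns (Suc n) l"
  then have "p = (p(Suc n := undefined))(Suc n := l)" by (auto simp: gt_patterns_def)
  moreover have "p(Suc n := undefined) \<in> gt_patterns n (p n)" using p by (auto simp: gt_patterns_def)
  moreover have "p n \<in> interlacing n l" using p by (auto simp: gt_patterns_def)
  ultimately show "p \<in> (\<Union>m\<in>interlacing n l. (\<lambda>p. p(Suc n := l)) ` gt_patterns n m)" by blast
qed (auto simp: gt_patterns_def less_Suc_eq)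

lemma finite_gt_patterns: "finite (gt_patterns n l)"
  by (induction n arbitrary: l) (auto simp: gt_patterns_0 gt_patterns_Suc finite_interlacing)

lemma sum_gt_patterns_Suc:
  "(\<Sum>p\<in>gt_patterns (Suc n) l. F p) =
    (\<Sum>m\<in>interlacing n l. \<Sum>p\<in>gt_patterns n m. F (p(Suc n := l)))"
proof -
  have inj: "inj_on (\<lambda>p. p(Suc n := l)) (gt_patterns n m)" for m
  proof (rule inj_onI)
    fix p q assume pq: "p \<in> gt_patterns n m" "q \<in> gt_patterns n m" "p(Suc n := l) = q(Suc n := l)"
    have "p i = q i" for i
    proof (cases "i = Suc n")
      case True
      then show ?thesis using pq(1,2) by (simp add: gt_patterns_def)
    next
      case False
      then show ?thesis using fun_cong[OF pq(3), of i] by simp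
    qed
    then show "p = q" by auto
  qed
  have "(\<lambda>p. p(Suc n := l)) ` gt_patterns n m \<inter> (\<lambda>p. p(Suc n := l)) ` gt_patterns n m' = {}"
    if "m \<noteq> m'" for m m'
  proof -
    have "q n = m" if "q \<in> (\<lambda>p. p(Suc n := l)) ` gt_patterns n m" for q m
      using that by (auto simp: gt_patterns_def)
    with \<open>m \<noteq> m'\<close> show ?thesis by blast
  qed
  then have "(\<Sum>p\<in>gt_patterns (Suc n) l. F p) =
      (\<Sum>m\<in>interlacing n l. \<Sum>p\<in>(\<lambda>p. p(Suc n := l)) ` gt_patterns n m. F p)"
    unfolding gt_patterns_Suc
    by (intro sum.UNION_disjoint) (auto simp: finite_interlacing finite_gt_patterns)
  then show ?thesis by (simp add: sum.reindex[OF inj] o_def)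
qed

lemma card_gt_patterns:
  "strict_mono_on {..<n} l \<Longrightarrow> real (card (gt_patterns n l)) = vandermonde n l"
proof (induction n arbitrary: l)
  case 0
  then show ?case by (simp add: gt_patterns_0 vandermonde_def alternant_def)
next
  case (Suc n)
  have "real (card (gt_patterns (Suc n) l)) = (\<Sum>m\<in>interlacing n l. real (card (gt_patterns n m)))"
    using sum_gt_patterns_Suc[of "\<lambda>_. 1::real" n l] by simp
  also have "\<dots> = (\<Sum>m\<in>interlacing n l. vandermonde n m)"
    by (intro sum.cong refl Suc.IH strict_mono_interlacing[OF Suc.prems])
  also have "\<dots> = vandermonde (Suc n) l" by (rule sum_interlacing_vandermonde[OF Suc.prems])
  finally show ?case .
qed

text \<open>Repeating each row without its last entry gives a pattern.\<close>

lemma gt_patterns_nonempty: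
  assumes "strict_mono_on {..<n} l"
  shows "gt_patterns n l \<noteq> {}"
  using assms
proof (induction n arbitrary: l)
  case 0
  then show ?case by (simp add: gt_patterns_0)
next
  case (Suc n)
  have m: "restrict l {..<n} \<in> interlacing n l"
    using strict_mono_onD[OF Suc.prems] by (auto simp: interlacing_def)
  then obtain p where "p \<in> gt_patterns n (restrict l {..<n})"
    using Suc.IH[OF strict_mono_interlacing[OF Suc.prems m]] by blast
  with m show ?case unfolding gt_patterns_Suc by blast
qed

text \<open>A statistic \<open>\<phi>\<close> of row \<open>k\<close>, multiplied by the number of ways to complete the pattern below that row, is
  pushed upwards row by row; \<open>X\<close> is what it becomes on the way.\<close>

lemma sum_gt_patterns_row:
  assumes "k \<le> n" and "strict_mono_on {..<n} l"
    and row: "\<And>m. strict_mono_on {..<k} m \<Longrightarrow> \<phi> m * vandermonde k m = X k m"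
    and step: "\<And>i m. \<lbrakk>k \<le> i; strict_mono_on {..<Suc i} m\<rbrakk> \<Longrightarrow> (\<Sum>m'\<in>interlacing i m. X i m') = X (Suc i) m"
  shows "(\<Sum>p\<in>gt_patterns n l. \<phi> (p k)) = X n l"
  using assms(1,2)
proof (induction n arbitrary: l rule: dec_induct)
  case base
  have "(\<Sum>p\<in>gt_patterns k l. \<phi> (p k)) = (\<Sum>p\<in>gt_patterns k l. \<phi> l)"
    by (rule sum.cong) (auto simp: gt_patterns_def)
  then show ?case using row[OF base] card_gt_patterns[OF base] by (simp add: mult.commute)
next
  case (step n)
  have "(\<Sum>p\<in>gt_patterns (Suc n) l. \<phi> (p k)) = (\<Sum>m\<in>interlacing n l. \<Sum>p\<in>gt_patterns n m. \<phi> (p k))"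
    using step.hyps by (simp add: sum_gt_patterns_Suc)
  also have "\<dots> = (\<Sum>m\<in>interlacing n l. X n m)"
    by (intro sum.cong refl step.IH strict_mono_interlacing[OF step.prems])
  also have "\<dots> = X (Suc n) l" using step.hyps step.prems assms(4) by blast
  finally show ?case .
qed

lemma sum_gt_patterns_power_sum_1:
  assumes "1 \<le> k" "k \<le> n" "strict_mono_on {..<n} l"
  shows "(\<Sum>p\<in>gt_patterns n l. \<Sum>i<k. real (p k i)) =
    real k * alternant_1 n l + real k * (real k - 1) / 2 * vandermonde n l"
proof (rule sum_gt_patterns_row[OF assms(2,3), where
      X = "\<lambda>n l. real k * alternant_1 n l + real k * (real k - 1) / 2 * vandermonde n l"])
  fix i and m :: "nat \<Rightarrow> nat" assume i: "k \<le> i" "strict_mono_on {..<Suc i} m"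
  then have "1 \<le> i" using assms(1) by simp
  with i show "(\<Sum>m'\<in>interlacing i m. real k * alternant_1 i m' + real k * (real k - 1) / 2 * vandermonde i m') =
    real k * alternant_1 (Suc i) m + real k * (real k - 1) / 2 * vandermonde (Suc i) m"
    unfolding sum.distrib sum_distrib_left[symmetric]
    by (simp only: sum_interlacing_alternant_1 sum_interlacing_vandermonde)
qed (rule power_sum_1_vandermonde)

lemma sum_gt_patterns_power_sum_2:
  assumes "1 \<le> k" "k \<le> n" "strict_mono_on {..<n} l"
  shows "(\<Sum>p\<in>gt_patterns n l. \<Sum>i<k. (real (p k i))\<^sup>2) =
    real k * (real k + 1) * alternant_2 n l - real k * (real k - 1) * alternant_11 n l
    + real k * (2 * real k - 1) * alternant_1 n l + (\<Sum>j<k. (real j)\<^sup>2) * vandermonde n l"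
proof (rule sum_gt_patterns_row[OF assms(2,3), where
      X = "\<lambda>n l. real k * (real k + 1) * alternant_2 n l - real k * (real k - 1) * alternant_11 n l
    + real k * (2 * real k - 1) * alternant_1 n l + (\<Sum>j<k. (real j)\<^sup>2) * vandermonde n l"])
  fix i and m :: "nat \<Rightarrow> nat" assume i: "k \<le> i" "strict_mono_on {..<Suc i} m"
  then have "1 \<le> i" using assms(1) by simp
  have *: "real k * (real k - 1) * (\<Sum>m'\<in>interlacing i m. alternant_11 i m') =
      real k * (real k - 1) * alternant_11 (Suc i) m"
  proof (cases "k = 1")
    case False
    then show ?thesis using i assms(1) by (simp add: sum_interlacing_alternant_11)
  qed simp
  show "(\<Sum>m'\<in>interlacing i m. real k * (real k + 1) * alternant_2 i m' - real k * (real k - 1) * alternant_11 i m'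
    + real k * (2 * real k - 1) * alternant_1 i m' + (\<Sum>j<k. (real j)\<^sup>2) * vandermonde i m') =
    real k * (real k + 1) * alternant_2 (Suc i) m - real k * (real k - 1) * alternant_11 (Suc i) m
    + real k * (2 * real k - 1) * alternant_1 (Suc i) m + (\<Sum>j<k. (real j)\<^sup>2) * vandermonde (Suc i) m"
    unfolding sum.distrib sum_subtractf sum_distrib_left[symmetric] *
    using i \<open>1 \<le> i\<close>
    by (simp only: sum_interlacing_alternant_2 sum_interlacing_alternant_1 sum_interlacing_vandermonde)
qed (use assms(1) in \<open>auto simp: power_sum_2_vandermonde\<close>)

section \<open>Lozenges in oblique coordinates\<close>

definition obl_x :: "real \<times> real \<Rightarrow> real" where
  "obl_x p = 2 * fst p / sqrt 3"

definition obl_y :: "real \<times> real \<Rightarrow> real" where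
  "obl_y p = snd p + fst p / sqrt 3"

lemma oblique_eq: "oblique x y = (x * sqrt 3 / 2, y - x / 2)"
  by (simp add: oblique_def e1_def e2_def)

lemma obl_x_oblique [simp]: "obl_x (oblique x y) = x"
  by (simp add: oblique_eq obl_x_def)

lemma obl_y_oblique [simp]: "obl_y (oblique x y) = y"
  by (simp add: oblique_eq obl_y_def)

lemma oblique_obl [simp]: "oblique (obl_x p) (obl_y p) = p"
  by (simp add: oblique_eq obl_x_def obl_y_def prod_eq_iff field_simps)

lemma oblique_inject [simp]: "oblique x y = oblique x' y' \<longleftrightarrow> x = x' \<and> y = y'"
  by (metis obl_x_oblique obl_y_oblique)

lemma obl_x_add [simp]: "obl_x (p + q) = obl_x p + obl_x q"
  and obl_y_add [simp]: "obl_y (p + q) = obl_y p + obl_y q"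
  and obl_x_diff [simp]: "obl_x (p - q) = obl_x p - obl_x q"
  and obl_y_diff [simp]: "obl_y (p - q) = obl_y p - obl_y q"
  and obl_x_scaleR [simp]: "obl_x (c *\<^sub>R p) = c * obl_x p"
  and obl_y_scaleR [simp]: "obl_y (c *\<^sub>R p) = c * obl_y p"
  by (simp_all add: obl_x_def obl_y_def field_simps)

lemma continuous_obl [continuous_intros]: "continuous_on S obl_x" "continuous_on S obl_y"
  unfolding obl_x_def obl_y_def by (auto intro!: continuous_intros)

lemma obl_eqI: "obl_x p = obl_x q \<Longrightarrow> obl_y p = obl_y q \<Longrightarrow> p = q"
  by (metis oblique_obl)

definition edge_direction :: "int \<Rightarrow> int \<Rightarrow> bool" where
  "edge_direction u v \<longleftrightarrow> (u, v) \<in> {(1, 0), (- 1, 0), (0, 1), (0, - 1), (1, 1), (- 1, - 1)}"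

text \<open>The quadratic form is the squared length of \<open>u e1 + v e2\<close>, so its solutions are the six shortest lattice
  vectors.\<close>

lemma norm_form_eq_1_iff: "u * u - u * v + v * v = (1::int) \<longleftrightarrow> edge_direction u v"
proof
  assume eq: "u * u - u * v + v * v = 1"
  \<comment> \<open>Completing the square in either variable bounds the other one.\<close>
  have "(2 * u - v)\<^sup>2 + 3 * v\<^sup>2 = 4 * (u * u - u * v + v * v)"
    "(2 * v - u)\<^sup>2 + 3 * u\<^sup>2 = 4 * (u * u - u * v + v * v)"
    by (simp_all add: power2_eq_square algebra_simps)
  then have "(2 * u - v)\<^sup>2 + 3 * v\<^sup>2 = 4" "(2 * v - u)\<^sup>2 + 3 * u\<^sup>2 = 4"
    by (simp_all only: eq)
  then have "3 * v\<^sup>2 \<le> 4" and "3 * u\<^sup>2 \<le> 4"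
    by (metis le_add_same_cancel2 zero_le_power2)+
  then have "v\<^sup>2 < 2\<^sup>2" "u\<^sup>2 < 2\<^sup>2" by auto
  then have "\<bar>v\<bar> < 2" "\<bar>u\<bar> < 2" using abs_le_square_iff[of 2 u] abs_le_square_iff[of 2 v] by auto
  then have "u \<in> {-1, 0, 1}" "v \<in> {-1, 0, 1}" by auto
  then show "edge_direction u v" using eq by (auto simp: edge_direction_def)
qed (auto simp: edge_direction_def)

lemma dist_lattice_eq_1_iff:
  "dist (oblique (of_int i) (of_int j)) (oblique (of_int k) (of_int l)) = 1 \<longleftrightarrow> edge_direction (k - i) (l - j)"
proof -
  let ?u = "k - i" and ?v = "l - j"
  have "(dist (oblique (of_int i) (of_int j)) (oblique (of_int k) (of_int l)))\<^sup>2 =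
      (dist (i * sqrt 3 / 2) (k * sqrt 3 / 2))\<^sup>2 + (dist (j - i / 2) (l - k / 2))\<^sup>2"
    by (simp add: oblique_eq dist_prod_def)
  also have "\<dots> = (real_of_int ?u * sqrt 3 / 2)\<^sup>2 + (?v - ?u / 2)\<^sup>2"
    unfolding dist_real_def power2_abs by (simp add: power2_eq_square field_simps)
  also have "\<dots> = of_int (?u * ?u - ?u * ?v + ?v * ?v)"
    by (simp add: power2_eq_square field_simps)
  finally have "(dist (oblique (of_int i) (of_int j)) (oblique (of_int k) (of_int l)))\<^sup>2 = 1 \<longleftrightarrow>
      ?u * ?u - ?u * ?v + ?v * ?v = 1"
    by (simp only: of_int_eq_1_iff)
  then show ?thesis
    unfolding norm_form_eq_1_iff by (metis one_power2 power2_eq_iff_nonneg zero_le_dist zero_le_one)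
qed

text \<open>The diagonal of direction \<open>e1 + e2\<close> cuts the unit rhombus with lower left corner \<open>(i, j)\<close> into the unit
  triangles \<open>Below i j\<close> and \<open>Above i j\<close>.\<close>

datatype cell = Below int int | Above int int

text \<open>A lozenge is named after the edge shared by its two triangles: this edge starts at \<open>(i, j)\<close> and has direction
  \<open>e2\<close>, \<open>e1\<close> or \<open>e1 + e2\<close>. Thus the tiles \<open>Ver\<close> are the horizontal lozenges.\<close>

datatype tile = Ver int int | Flat int int | Diag int int

fun corners :: "cell \<Rightarrow> (real \<times> real) set" where
  "corners (Below i j) = {oblique i j, oblique (i + 1) j, oblique (i + 1) (j + 1)}"
| "corners (Above i j) = {oblique i j, oblique (i + 1) (j + 1), oblique i (j + 1)}"

fun region :: "cell \<Rightarrow> (real \<times> real) set" where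
  "region (Below i j) = {p. j \<le> obl_y p \<and> obl_y p - j \<le> obl_x p - i \<and> obl_x p \<le> i + 1}"
| "region (Above i j) = {p. i \<le> obl_x p \<and> obl_x p - i \<le> obl_y p - j \<and> obl_y p \<le> j + 1}"

lemma convex_hull_corners: "convex hull (corners c) = region c"
proof (cases c)
  case (Below i j)
  show ?thesis
  proof (intro equalityI subsetI)
    fix p assume "p \<in> convex hull (corners c)"
    then obtain u v w where *: "0 \<le> u" "0 \<le> v" "0 \<le> w" "u + v + w = 1"
      "p = u *\<^sub>R oblique i j + v *\<^sub>R oblique (i + 1) j + w *\<^sub>R oblique (i + 1) (j + 1)"
      unfolding Below corners.simps convex_hull_3 by blast
    have u: "u = 1 - v - w" using *(4) by simp
    show "p \<in> region c" using *(1-3) unfolding Below *(5) u by (simp add: algebra_simps)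
  next
    fix p assume p: "p \<in> region c"
    define w where "w = obl_y p - j"
    define v where "v = (obl_x p - i) - w"
    have "p = (1 - v - w) *\<^sub>R oblique i j + v *\<^sub>R oblique (i + 1) j + w *\<^sub>R oblique (i + 1) (j + 1)"
      by (rule obl_eqI) (simp_all add: v_def w_def algebra_simps)
    moreover have "0 \<le> 1 - v - w" "0 \<le> v" "0 \<le> w" "(1 - v - w) + v + w = 1"
      using p by (auto simp: Below v_def w_def)
    ultimately show "p \<in> convex hull (corners c)"
      unfolding Below corners.simps convex_hull_3 by blast
  qed
next
  case (Above i j)
  show ?thesis
  proof (intro equalityI subsetI)
    fix p assume "p \<in> convex hull (corners c)"
    then obtain u v w where *: "0 \<le> u" "0 \<le> v" "0 \<le> w" "u + v + w = 1"
      "p = u *\<^sub>R oblique i j + v *\<^sub>R oblique (i + 1) (j + 1) + w *\<^sub>R oblique i (j + 1)"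
      unfolding Above corners.simps convex_hull_3 by blast
    have u: "u = 1 - v - w" using *(4) by simp
    show "p \<in> region c" using *(1-3) unfolding Above *(5) u by (simp add: algebra_simps)
  next
    fix p assume p: "p \<in> region c"
    define v where "v = obl_x p - i"
    define w where "w = (obl_y p - j) - v"
    have "p = (1 - v - w) *\<^sub>R oblique i j + v *\<^sub>R oblique (i + 1) (j + 1) + w *\<^sub>R oblique i (j + 1)"
      by (rule obl_eqI) (simp_all add: v_def w_def algebra_simps)
    moreover have "0 \<le> 1 - v - w" "0 \<le> v" "0 \<le> w" "(1 - v - w) + v + w = 1"
      using p by (auto simp: Above v_def w_def)
    ultimately show "p \<in> convex hull (corners c)"
      unfolding Above corners.simps convex_hull_3 by blast
  qed
qed

fun cells_of :: "tile \<Rightarrow> cell set" where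
  "cells_of (Ver i j) = {Below (i - 1) j, Above i j}"
| "cells_of (Flat i j) = {Above i (j - 1), Below i j}"
| "cells_of (Diag i j) = {Below i j, Above i j}"

definition lozenge_of :: "tile \<Rightarrow> (real \<times> real) set" where
  "lozenge_of t = \<Union> (region ` cells_of t)"


text \<open>The common edge has one of six directions, and the points at distance 1 from both of its ends are the third
  corners of the two triangles on it.\<close>

lemma lozenges_eq: "lozenges = range lozenge_of"
proof (intro equalityI subsetI)
  fix s assume "s \<in> lozenges"
  then obtain p q r r' where s: "s = convex hull {p, q, r} \<union> convex hull {p, q, r'}"
    and t: "unit_triangle p q r" "unit_triangle p q r'" "r \<noteq> r'"
    by (auto simp: lozenges_def)
  then obtain i j k l m n m' n' :: int where
    pq: "p = oblique i j" "q = oblique k l" "r = oblique m n" "r' = oblique m' n'"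
    by (auto simp: unit_triangle_def lattice_points_def)
  have dir: "edge_direction (k - i) (l - j)" "edge_direction (m - k) (n - l)" "edge_direction (i - m) (j - n)"
    "edge_direction (m' - k) (n' - l)" "edge_direction (i - m') (j - n')"
    using t by (auto simp: unit_triangle_def pq dist_lattice_eq_1_iff)
  have ne: "m \<noteq> m' \<or> n \<noteq> n'" using t(3) by (auto simp: pq)
  have on_edge: "s = lozenge_of t"
    if "(m, n, m', n') = (x, y, x', y') \<or> (m', n', m, n) = (x, y, x', y')"
      and "{p, q, oblique x y} = corners c" "{p, q, oblique x' y'} = corners c'" "cells_of t = {c, c'}"
    for t c c' and x y x' y' :: int
  proof -
    have "s = convex hull {p, q, oblique x y} \<union> convex hull {p, q, oblique x' y'}"
      using that(1) by (auto simp: s pq(3,4))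
    then show ?thesis
      unfolding that(2,3) convex_hull_corners lozenge_of_def that(4) by simp
  qed
  consider "k = i + 1 \<and> l = j" | "k = i - 1 \<and> l = j" | "k = i \<and> l = j + 1" | "k = i \<and> l = j - 1"
    | "k = i + 1 \<and> l = j + 1" | "k = i - 1 \<and> l = j - 1"
    using dir(1) by (auto simp: edge_direction_def)
  then show "s \<in> range lozenge_of"
  proof cases
    case 1
    have "m = i + 1 \<and> n = j + 1 \<or> m = i \<and> n = j - 1"
      using dir(2,3) 1 by (auto simp: edge_direction_def)
    moreover have "m' = i + 1 \<and> n' = j + 1 \<or> m' = i \<and> n' = j - 1"
      using dir(4,5) 1 by (auto simp: edge_direction_def)
    ultimately have "(m, n, m', n') = (i + 1, j + 1, i, j - 1) \<or> (m', n', m, n) = (i + 1, j + 1, i, j - 1)"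
      using ne by auto
    then have "s = lozenge_of (Flat i j)"
      by (rule on_edge[where c = "Below i j" and c' = "Above i (j - 1)"]) (simp_all add: 1 pq insert_commute)
    then show ?thesis by blast
  next
    case 2
    have "m = i \<and> n = j + 1 \<or> m = i - 1 \<and> n = j - 1"
      using dir(2,3) 2 by (auto simp: edge_direction_def)
    moreover have "m' = i \<and> n' = j + 1 \<or> m' = i - 1 \<and> n' = j - 1"
      using dir(4,5) 2 by (auto simp: edge_direction_def)
    ultimately have "(m, n, m', n') = (i, j + 1, i - 1, j - 1) \<or> (m', n', m, n) = (i, j + 1, i - 1, j - 1)"
      using ne by auto
    then have "s = lozenge_of (Flat k j)"
      by (rule on_edge[where c = "Below k j" and c' = "Above k (j - 1)"]) (simp_all add: 2 pq insert_commute)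
    then show ?thesis by blast
  next
    case 3
    have "m = i + 1 \<and> n = j + 1 \<or> m = i - 1 \<and> n = j"
      using dir(2,3) 3 by (auto simp: edge_direction_def)
    moreover have "m' = i + 1 \<and> n' = j + 1 \<or> m' = i - 1 \<and> n' = j"
      using dir(4,5) 3 by (auto simp: edge_direction_def)
    ultimately have "(m, n, m', n') = (i + 1, j + 1, i - 1, j) \<or> (m', n', m, n) = (i + 1, j + 1, i - 1, j)"
      using ne by auto
    then have "s = lozenge_of (Ver i j)"
      by (rule on_edge[where c = "Above i j" and c' = "Below (i - 1) j"]) (simp_all add: 3 pq insert_commute)
    then show ?thesis by blast
  next
    case 4
    have "m = i + 1 \<and> n = j \<or> m = i - 1 \<and> n = j - 1"
      using dir(2,3) 4 by (auto simp: edge_direction_def)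
    moreover have "m' = i + 1 \<and> n' = j \<or> m' = i - 1 \<and> n' = j - 1"
      using dir(4,5) 4 by (auto simp: edge_direction_def)
    ultimately have "(m, n, m', n') = (i + 1, j, i - 1, j - 1) \<or> (m', n', m, n) = (i + 1, j, i - 1, j - 1)"
      using ne by auto
    then have "s = lozenge_of (Ver i l)"
      by (rule on_edge[where c = "Above i l" and c' = "Below (i - 1) l"]) (simp_all add: 4 pq insert_commute)
    then show ?thesis by blast
  next
    case 5
    have "m = i + 1 \<and> n = j \<or> m = i \<and> n = j + 1"
      using dir(2,3) 5 by (auto simp: edge_direction_def)
    moreover have "m' = i + 1 \<and> n' = j \<or> m' = i \<and> n' = j + 1"
      using dir(4,5) 5 by (auto simp: edge_direction_def)
    ultimately have "(m, n, m', n') = (i + 1, j, i, j + 1) \<or> (m', n', m, n) = (i + 1, j, i, j + 1)"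
      using ne by auto
    then have "s = lozenge_of (Diag i j)"
      by (rule on_edge[where c = "Below i j" and c' = "Above i j"]) (simp_all add: 5 pq insert_commute)
    then show ?thesis by blast
  next
    case 6
    have "m = i \<and> n = j - 1 \<or> m = i - 1 \<and> n = j"
      using dir(2,3) 6 by (auto simp: edge_direction_def)
    moreover have "m' = i \<and> n' = j - 1 \<or> m' = i - 1 \<and> n' = j"
      using dir(4,5) 6 by (auto simp: edge_direction_def)
    ultimately have "(m, n, m', n') = (i, j - 1, i - 1, j) \<or> (m', n', m, n) = (i, j - 1, i - 1, j)"
      using ne by auto
    then have "s = lozenge_of (Diag k l)"
      by (rule on_edge[where c = "Below k l" and c' = "Above k l"]) (simp_all add: 6 pq insert_commute)
    then show ?thesis by blast
  qed
next
  fix s assume "s \<in> range lozenge_of"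
  then obtain t where s: "s = lozenge_of t" by blast
  have tri: "unit_triangle (oblique i j) (oblique k l) (oblique m n)"
    if "edge_direction (k - i) (l - j)" "edge_direction (m - k) (n - l)" "edge_direction (i - m) (j - n)"
    for i j k l m n :: int
    using that by (auto simp: unit_triangle_def lattice_points_def dist_lattice_eq_1_iff)
  have lozI: "s \<in> lozenges"
    if "cells_of t = {c, c'}" "corners c = {oblique i j, oblique k l, oblique m n}"
      "corners c' = {oblique i j, oblique k l, oblique m' n'}" "(m, n) \<noteq> (m', n')"
      "edge_direction (k - i) (l - j)" "edge_direction (m - k) (n - l)" "edge_direction (i - m) (j - n)"
      "edge_direction (m' - k) (n' - l)" "edge_direction (i - m') (j - n')"
    for c c' and i j k l m n m' n' :: int
  proof -
    have "s = convex hull (corners c) \<union> convex hull (corners c')"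
      by (simp add: s lozenge_of_def that(1) convex_hull_corners)
    then show ?thesis
      unfolding lozenges_def that(2,3) using tri[OF that(5,6,7)] tri[OF that(5,8,9)] that(4)
      by (intro CollectI exI[of _ "oblique i j"] exI[of _ "oblique k l"] exI[of _ "oblique m n"]
          exI[of _ "oblique m' n'"]) auto
  qed
  show "s \<in> lozenges"
  proof (cases t)
    case (Ver i j)
    show ?thesis
      by (rule lozI[of "Below (i - 1) j" "Above i j" i j i "j + 1" "i - 1" j "i + 1" "j + 1"])
         (auto simp: Ver edge_direction_def insert_commute)
  next
    case (Flat i j)
    show ?thesis
      by (rule lozI[of "Above i (j - 1)" "Below i j" i j "i + 1" j i "j - 1" "i + 1" "j + 1"])
         (auto simp: Flat edge_direction_def insert_commute)
  next
    case (Diag i j)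
    show ?thesis
      by (rule lozI[of "Below i j" "Above i j" i j "i + 1" "j + 1" "i + 1" j i "j + 1"])
         (auto simp: Diag edge_direction_def insert_commute)
  qed
qed

lemma horizontal_lozenge_eq: "horizontal_lozenge x y = lozenge_of (Ver x y)"
proof (intro equalityI)
  let ?V = "{oblique (of_int x) (of_int y), oblique (of_int (x + 1)) (of_int (y + 1)),
      oblique (of_int x) (of_int (y + 1)), oblique (of_int (x - 1)) (of_int y)}"
  have eq: "lozenge_of (Ver x y) = {p. y \<le> obl_y p \<and> obl_y p \<le> y + 1 \<and>
      obl_y p - y \<le> obl_x p - (x - 1) \<and> obl_x p - x \<le> obl_y p - y}"
    by (auto simp: lozenge_of_def)
  have "convex {p. y \<le> obl_y p \<and> obl_y p \<le> y + 1 \<and>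
      obl_y p - y \<le> obl_x p - (x - 1) \<and> obl_x p - x \<le> obl_y p - y}" (is "convex ?R")
  proof (rule convexI)
    fix p q :: "real \<times> real" and u v :: real
    assume *: "p \<in> ?R" "q \<in> ?R" "0 \<le> u" "0 \<le> v" "u + v = 1"
    have v: "v = 1 - u" using * by simp
    have "0 \<le> u * (obl_y p - y) + v * (obl_y q - y)"
      "0 \<le> u * (y + 1 - obl_y p) + v * (y + 1 - obl_y q)"
      "0 \<le> u * (obl_x p - (x - 1) - (obl_y p - y)) + v * (obl_x q - (x - 1) - (obl_y q - y))"
      "0 \<le> u * (obl_y p - y - (obl_x p - x)) + v * (obl_y q - y - (obl_x q - x))"
      using * by (auto intro!: add_nonneg_nonneg mult_nonneg_nonneg)
    then show "u *\<^sub>R p + v *\<^sub>R q \<in> ?R" by (simp add: v algebra_simps)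
  qed
  then show "horizontal_lozenge x y \<subseteq> lozenge_of (Ver x y)"
    unfolding horizontal_lozenge_def eq by (intro hull_minimal) auto
  have "convex hull (corners c) \<subseteq> convex hull ?V" if "c \<in> cells_of (Ver x y)" for c
    using that by (intro hull_mono) auto
  then show "lozenge_of (Ver x y) \<subseteq> horizontal_lozenge x y"
    unfolding lozenge_of_def horizontal_lozenge_def convex_hull_corners by blast
qed

section \<open>Tilings as perfect matchings of unit triangles\<close>

text \<open>The points that lie on no line of the triangular lattice.\<close>

definition generic :: "real \<times> real \<Rightarrow> bool" where
  "generic p \<longleftrightarrow> obl_x p \<notin> \<int> \<and> obl_y p \<notin> \<int> \<and> obl_x p - obl_y p \<notin> \<int>"

text \<open>The line of direction \<open>(1, 2)\<close> through a point of \<open>U\<close> meets each lattice line at most once, hence has only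
  countably many points that are not generic.\<close>

lemma open_contains_generic:
  assumes "open U" "U \<noteq> {}"
  obtains p where "p \<in> U" "generic p"
proof -
  obtain q where q: "q \<in> U" using assms by blast
  \<comment> \<open>Along this direction the three coordinates \<open>x\<close>, \<open>y\<close> and \<open>x - y\<close> all vary.\<close>
  define f where "f t = q + t *\<^sub>R oblique 1 2" for t :: real
  have "open (f -` U)"
    unfolding f_def by (intro open_vimage assms(1) continuous_intros)
  moreover have "0 \<in> f -` U" using q by (simp add: f_def)
  ultimately obtain e where e: "e > 0" "ball 0 e \<subseteq> f -` U" by (meson open_contains_ball)
  let ?B = "(\<lambda>n. n - obl_x q) ` \<int> \<union> (\<lambda>n. (n - obl_y q) / 2) ` \<int> \<union> (\<lambda>n. (obl_x q - obl_y q) - n) ` \<int>"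
  have "countable ?B" by (intro countable_Un countable_image countable_int)
  moreover have "uncountable {0<..<e}" using e(1) by (simp add: uncountable_open_interval)
  ultimately have "\<not> {0<..<e} \<subseteq> ?B" by (meson countable_subset)
  then obtain t where t: "t \<in> {0<..<e}" "t \<notin> ?B" unfolding subset_iff by metis
  have "t \<in> ball 0 e" using t(1) by (simp add: dist_real_def)
  then have "f t \<in> U" using e(2) by blast
  moreover have "generic (f t)"
    unfolding generic_def
  proof (intro conjI notI)
    assume "obl_x (f t) \<in> \<int>"
    then have "t \<in> (\<lambda>n. n - obl_x q) ` \<int>"
      by (intro image_eqI[of _ _ "obl_x (f t)"]) (auto simp: f_def)
    then show False using t by blast
  next
    assume "obl_y (f t) \<in> \<int>"
    then have "t \<in> (\<lambda>n. (n - obl_y q) / 2) ` \<int>"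
      by (intro image_eqI[of _ _ "obl_y (f t)"]) (auto simp: f_def)
    then show False using t by blast
  next
    assume "obl_x (f t) - obl_y (f t) \<in> \<int>"
    then have "t \<in> (\<lambda>n. (obl_x q - obl_y q) - n) ` \<int>"
      by (intro image_eqI[of _ _ "obl_x (f t) - obl_y (f t)"]) (auto simp: f_def)
    then show False using t by blast
  qed
  ultimately show ?thesis using that by blast
qed

definition cell_at :: "real \<times> real \<Rightarrow> cell" where
  "cell_at p = (if frac (obl_y p) < frac (obl_x p) then Below \<lfloor>obl_x p\<rfloor> \<lfloor>obl_y p\<rfloor>
     else Above \<lfloor>obl_x p\<rfloor> \<lfloor>obl_y p\<rfloor>)"

lemma less_of_int_of_notin_Ints: "x \<notin> \<int> \<Longrightarrow> x \<le> of_int n \<longleftrightarrow> x < (of_int n :: real)"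
  "x \<notin> \<int> \<Longrightarrow> of_int n \<le> x \<longleftrightarrow> of_int n < x"
  by (auto simp: order_le_less)

lemma generic_floor:
  assumes "generic p"
  shows "\<lfloor>obl_x p\<rfloor> < obl_x p" "\<lfloor>obl_y p\<rfloor> < obl_y p" "obl_x p < \<lfloor>obl_x p\<rfloor> + 1" "obl_y p < \<lfloor>obl_y p\<rfloor> + 1"
    "obl_x p - obl_y p \<noteq> real_of_int n" "obl_x p \<noteq> real_of_int n" "obl_y p \<noteq> real_of_int n"
  using assms less_of_int_of_notin_Ints(2)[of "obl_x p" "\<lfloor>obl_x p\<rfloor>"] less_of_int_of_notin_Ints(2)[of "obl_y p" "\<lfloor>obl_y p\<rfloor>"]
  by (auto simp: generic_def)

lemma generic_in_region_iff:
  assumes "generic p"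
  shows "p \<in> region c \<longleftrightarrow> c = cell_at p"
proof (cases c)
  case (Below i j)
  have "\<lfloor>obl_x p\<rfloor> = i \<and> \<lfloor>obl_y p\<rfloor> = j \<and> frac (obl_y p) < frac (obl_x p)" if "p \<in> region c"
  proof -
    have "j < obl_y p" "obl_y p - j < obl_x p - i" "obl_x p < i + 1"
      using that generic_floor(5)[OF assms, of "i - j"] generic_floor(6)[OF assms, of "i + 1"]
        generic_floor(7)[OF assms, of j] by (auto simp: Below less_le)
    moreover from this have "\<lfloor>obl_x p\<rfloor> = i" "\<lfloor>obl_y p\<rfloor> = j" by (simp_all add: floor_eq_iff)
    ultimately show ?thesis by (simp add: frac_def)
  qed
  moreover have "p \<in> region c" if "\<lfloor>obl_x p\<rfloor> = i" "\<lfloor>obl_y p\<rfloor> = j" "frac (obl_y p) < frac (obl_x p)"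
    using that generic_floor(1-4)[OF assms] by (auto simp: Below frac_def)
  ultimately have "p \<in> region c \<longleftrightarrow> \<lfloor>obl_x p\<rfloor> = i \<and> \<lfloor>obl_y p\<rfloor> = j \<and> frac (obl_y p) < frac (obl_x p)"
    by blast
  then show ?thesis by (simp only:) (auto simp: Below cell_at_def)
next
  case (Above i j)
  have "\<lfloor>obl_x p\<rfloor> = i \<and> \<lfloor>obl_y p\<rfloor> = j \<and> \<not> frac (obl_y p) < frac (obl_x p)" if "p \<in> region c"
  proof -
    have "i < obl_x p" "obl_x p - i < obl_y p - j" "obl_y p < j + 1"
      using that generic_floor(5)[OF assms, of "i - j"] generic_floor(7)[OF assms, of "j + 1"]
        generic_floor(6)[OF assms, of i] by (auto simp: Above less_le)
    moreover from this have "\<lfloor>obl_x p\<rfloor> = i" "\<lfloor>obl_y p\<rfloor> = j" by (simp_all add: floor_eq_iff)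
    ultimately show ?thesis by (simp add: frac_def)
  qed
  moreover have "p \<in> region c" if "\<lfloor>obl_x p\<rfloor> = i" "\<lfloor>obl_y p\<rfloor> = j" "\<not> frac (obl_y p) < frac (obl_x p)"
    using that generic_floor(1-4)[OF assms] by (auto simp: Above frac_def)
  ultimately have "p \<in> region c \<longleftrightarrow> \<lfloor>obl_x p\<rfloor> = i \<and> \<lfloor>obl_y p\<rfloor> = j \<and> \<not> frac (obl_y p) < frac (obl_x p)"
    by blast
  then show ?thesis by (simp only:) (auto simp: Above cell_at_def)
qed

fun inner_region :: "cell \<Rightarrow> (real \<times> real) set" where
  "inner_region (Below i j) = {p. j < obl_y p \<and> obl_y p - j < obl_x p - i \<and> obl_x p < i + 1}"
| "inner_region (Above i j) = {p. i < obl_x p \<and> obl_x p - i < obl_y p - j \<and> obl_y p < j + 1}"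

lemma inner_region_subset_interior: "inner_region c \<subseteq> interior (region c)"
proof (rule interior_maximal)
  show "open (inner_region c)"
    by (cases c) (auto intro!: open_Collect_conj open_Collect_less continuous_intros)
qed (cases c; auto)

lemma generic_in_interior:
  assumes "generic p"
  shows "p \<in> interior (region (cell_at p))"
proof -
  have "p \<in> inner_region (cell_at p)"
    using generic_floor(1-4)[OF assms] generic_floor(5)[OF assms, of "\<lfloor>obl_x p\<rfloor> - \<lfloor>obl_y p\<rfloor>"]
    by (auto simp: cell_at_def frac_def)
  then show ?thesis using inner_region_subset_interior by blast
qed

lemma obtain_generic_in_cell:
  obtains p where "generic p" "cell_at p = c"
proof -
  have "inner_region c \<noteq> {}"
  proof (cases c)
    case (Below i j)
    then have "oblique (i + 2 / 3) (j + 1 / 3) \<in> inner_region c" by simp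
    then show ?thesis by blast
  next
    case (Above i j)
    then have "oblique (i + 1 / 3) (j + 2 / 3) \<in> inner_region c" by simp
    then show ?thesis by blast
  qed
  then have "interior (region c) \<noteq> {}" using inner_region_subset_interior by blast
  then obtain p where "p \<in> interior (region c)" "generic p"
    using open_contains_generic[OF open_interior] by metis
  then show ?thesis
    using that[of p] generic_in_region_iff[of p c] interior_subset[of "region c"] by blast
qed

lemma generic_in_lozenge_of_iff: "generic p \<Longrightarrow> p \<in> lozenge_of t \<longleftrightarrow> cell_at p \<in> cells_of t"
  by (auto simp: lozenge_of_def generic_in_region_iff)

lemma generic_in_interior_lozenge_of:
  assumes "generic p" "cell_at p \<in> cells_of t"
  shows "p \<in> interior (lozenge_of t)"
  using generic_in_interior[OF assms(1)] assms(2) interior_mono[of "region (cell_at p)" "lozenge_of t"]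
  by (auto simp: lozenge_of_def)

lemma cells_of_inject: "cells_of t = cells_of t' \<Longrightarrow> t = t'"
  by (cases t; cases t') (auto simp: doubleton_eq_iff)

lemma inj_lozenge_of: "inj lozenge_of"
proof (rule injI)
  have "cells_of t \<subseteq> cells_of t'" if "lozenge_of t = lozenge_of t'" for t t'
  proof
    fix c assume "c \<in> cells_of t"
    obtain p where "generic p" "cell_at p = c" by (rule obtain_generic_in_cell)
    then show "c \<in> cells_of t'" using \<open>c \<in> cells_of t\<close> that generic_in_lozenge_of_iff by metis
  qed
  then show "t = t'" if "lozenge_of t = lozenge_of t'" for t t'
    using that by (intro cells_of_inject equalityI) auto
qed

text \<open>For the inclusion of the points given by the inequalities: the vertical line through such a point meets
  the boundary of the hexagon in two points, each on the segment between two vertices, and the point lies between them.\<close>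

lemma mem_hexagon_iff:
  assumes "a > 0" "b > 0" "c > 0"
  shows "p \<in> hexagon a b c \<longleftrightarrow> 0 \<le> obl_x p \<and> obl_x p \<le> real (a + b) \<and> 0 \<le> obl_y p \<and> obl_y p \<le> real (a + c) \<and>
    obl_x p - obl_y p \<le> real b \<and> obl_y p - obl_x p \<le> real c" (is "_ \<longleftrightarrow> ?ineq p")
proof
  have "convex (Collect ?ineq)"
  proof (rule convexI)
    fix p q :: "real \<times> real" and u v :: real
    assume *: "p \<in> Collect ?ineq" "q \<in> Collect ?ineq" "0 \<le> u" "0 \<le> v" "u + v = 1"
    have v: "v = 1 - u" using * by simp
    have "0 \<le> u * obl_x p + v * obl_x q"
      "0 \<le> u * (a + b - obl_x p) + v * (a + b - obl_x q)"
      "0 \<le> u * obl_y p + v * obl_y q"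
      "0 \<le> u * (a + c - obl_y p) + v * (a + c - obl_y q)"
      "0 \<le> u * (b - (obl_x p - obl_y p)) + v * (b - (obl_x q - obl_y q))"
      "0 \<le> u * (c - (obl_y p - obl_x p)) + v * (c - (obl_y q - obl_x q))"
      using * by (auto intro!: add_nonneg_nonneg mult_nonneg_nonneg)
    then show "u *\<^sub>R p + v *\<^sub>R q \<in> Collect ?ineq" by (simp add: v algebra_simps)
  qed
  then have "hexagon a b c \<subseteq> Collect ?ineq"
    unfolding hexagon_def by (intro hull_minimal) auto
  then show "p \<in> hexagon a b c \<Longrightarrow> ?ineq p" by blast
next
  assume p: "?ineq p"
  let ?H = "hexagon a b c"
  have convex: "convex ?H" by (simp add: hexagon_def)
  have vertices: "oblique 0 0 \<in> ?H" "oblique (real b) 0 \<in> ?H" "oblique (real (a + b)) (real a) \<in> ?H"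
    "oblique (real (a + b)) (real (a + c)) \<in> ?H" "oblique (real a) (real (a + c)) \<in> ?H" "oblique 0 (real c) \<in> ?H"
    unfolding hexagon_def by (auto intro: hull_inc)
  have comb: "oblique x y \<in> ?H"
    if "oblique x0 y0 \<in> ?H" "oblique x1 y1 \<in> ?H" "0 \<le> t" "t \<le> 1" "x = x0 + t * (x1 - x0)" "y = y0 + t * (y1 - y0)"
    for x y x0 y0 x1 y1 t
  proof -
    have "oblique x y = (1 - t) *\<^sub>R oblique x0 y0 + t *\<^sub>R oblique x1 y1"
      by (rule obl_eqI) (simp_all add: that(5,6) algebra_simps)
    then show ?thesis using convexD_alt[OF convex that(1-4)] by simp
  qed
  define x where "x = obl_x p"
  \<comment> \<open>The ends of the intersection of the hexagon with the vertical line through the point.\<close>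
  define lo where "lo = max 0 (x - b)"
  define hi where "hi = min (a + c) (x + c)"
  have x: "0 \<le> x" "x \<le> real a + real b" using p by (simp_all add: x_def)
  have lo: "oblique x lo \<in> ?H"
  proof (cases "x \<le> b")
    case True
    show ?thesis
      by (rule comb[OF vertices(1,2), of "x / b"]) (use x assms True in \<open>simp_all add: lo_def\<close>)
  next
    case False
    show ?thesis
      by (rule comb[OF vertices(2,3), of "(x - b) / a"]) (use x assms False in \<open>simp_all add: lo_def\<close>)
  qed
  have hi: "oblique x hi \<in> ?H"
  proof (cases "x \<le> a")
    case True
    show ?thesis
      by (rule comb[OF vertices(6,5), of "x / a"]) (use x assms True in \<open>simp_all add: hi_def\<close>)
  next
    case False
    show ?thesis
      by (rule comb[OF vertices(5,4), of "(x - a) / b"]) (use x assms False in \<open>simp_all add: hi_def\<close>)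
  qed
  have lohi: "lo \<le> obl_y p" "obl_y p \<le> hi" using p by (auto simp: lo_def hi_def x_def)
  have "oblique x (obl_y p) \<in> ?H"
  proof (cases "lo = hi")
    case True
    then show ?thesis using lo lohi by (metis order_antisym)
  next
    case False
    show ?thesis
      by (rule comb[OF lo hi, of "(obl_y p - lo) / (hi - lo)"]) (use lohi False in simp_all)
  qed
  then show "p \<in> ?H" by (simp add: x_def)
qed

fun in_hex :: "nat \<Rightarrow> nat \<Rightarrow> nat \<Rightarrow> cell \<Rightarrow> bool" where
  "in_hex a b c (Below i j) \<longleftrightarrow> 0 \<le> i \<and> i < int a + int b \<and> 0 \<le> j \<and> j < int a + int c \<and> i - j < int b \<and> j - i \<le> int c"
| "in_hex a b c (Above i j) \<longleftrightarrow> 0 \<le> i \<and> i < int a + int b \<and> 0 \<le> j \<and> j < int a + int c \<and> i - j \<le> int b \<and> j - i < int c"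

lemma finite_in_hex: "finite {s. in_hex a b c s}"
proof (rule finite_subset)
  let ?I = "{0..int a + int b} \<times> {0..int a + int c}"
  show "{s. in_hex a b c s} \<subseteq> (\<lambda>(i, j). Below i j) ` ?I \<union> (\<lambda>(i, j). Above i j) ` ?I"
  proof
    fix s assume "s \<in> {s. in_hex a b c s}"
    then show "s \<in> (\<lambda>(i, j). Below i j) ` ?I \<union> (\<lambda>(i, j). Above i j) ` ?I"
      by (cases s) (auto simp: image_iff)
  qed
qed auto

lemma region_subset_hexagon:
  assumes "a > 0" "b > 0" "c > 0" "in_hex a b c s"
  shows "region s \<subseteq> hexagon a b c"
proof
  fix p assume p: "p \<in> region s"
  show "p \<in> hexagon a b c"
  proof (cases s)
    case (Below i j)
    then have "0 \<le> i" "i + 1 \<le> int a + int b" "0 \<le> j" "j + 1 \<le> int a + int c" "i + 1 - j \<le> int b" "j - i \<le> int c"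
      using assms(4) by auto
    then have "real_of_int 0 \<le> i" "real_of_int (i + 1) \<le> real_of_int (int a + int b)" "real_of_int 0 \<le> j"
      "real_of_int (j + 1) \<le> real_of_int (int a + int c)" "real_of_int (i + 1 - j) \<le> real_of_int (int b)"
      "real_of_int (j - i) \<le> real_of_int (int c)"
      by (simp_all only: of_int_le_iff)
    then show ?thesis using p unfolding mem_hexagon_iff[OF assms(1-3)] Below by auto
  next
    case (Above i j)
    then have "0 \<le> i" "i + 1 \<le> int a + int b" "0 \<le> j" "j + 1 \<le> int a + int c" "i - j \<le> int b" "j + 1 - i \<le> int c"
      using assms(4) by auto
    then have "real_of_int 0 \<le> i" "real_of_int (i + 1) \<le> real_of_int (int a + int b)" "real_of_int 0 \<le> j"
      "real_of_int (j + 1) \<le> real_of_int (int a + int c)" "real_of_int (i - j) \<le> real_of_int (int b)"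
      "real_of_int (j + 1 - i) \<le> real_of_int (int c)"
      by (simp_all only: of_int_le_iff)
    then show ?thesis using p unfolding mem_hexagon_iff[OF assms(1-3)] Above by auto
  qed
qed

lemma generic_in_hexagon:
  assumes "a > 0" "b > 0" "c > 0" "generic p" "p \<in> hexagon a b c"
  shows "in_hex a b c (cell_at p)"
proof -
  have p: "0 \<le> obl_x p" "obl_x p \<le> real (a + b)" "0 \<le> obl_y p" "obl_y p \<le> real (a + c)"
    "obl_x p - obl_y p \<le> real b" "obl_y p - obl_x p \<le> real c"
    using assms(5) by (auto simp: mem_hexagon_iff[OF assms(1-3)])
  have p': "obl_x p < real (a + b)" "obl_y p < real (a + c)"
    "obl_x p - obl_y p < real b" "obl_y p - obl_x p < real c"
    using p assms(4) less_of_int_of_notin_Ints(1)[of "obl_x p" "int (a + b)"]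
      less_of_int_of_notin_Ints(1)[of "obl_y p" "int (a + c)"]
      generic_floor(5)[OF assms(4), of "int b"] generic_floor(5)[OF assms(4), of "- int c"]
    by (auto simp: generic_def)
  define i j where "i = \<lfloor>obl_x p\<rfloor>" and "j = \<lfloor>obl_y p\<rfloor>"
  have fl: "i < obl_x p" "j < obl_y p" "obl_x p < i + 1" "obl_y p < j + 1"
    using generic_floor[OF assms(4)] by (auto simp: i_def j_def)
  have "0 \<le> i" "0 \<le> j" using p by (auto simp: i_def j_def)
  moreover have "i < int a + int b" "j < int a + int c" using p' by (simp_all add: i_def j_def floor_less_iff)
  moreover have "i - j < int b \<and> j - i \<le> int c" if "frac (obl_y p) < frac (obl_x p)"
  proof -
    have "obl_y p - j < obl_x p - i" using that by (simp add: frac_def i_def j_def)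
    then have "real_of_int (i - j) < real_of_int (int b)" "real_of_int (j - i) < real_of_int (int c + 1)"
      using p' fl by auto
    then show ?thesis by linarith
  qed
  moreover have "i - j \<le> int b \<and> j - i < int c" if "\<not> frac (obl_y p) < frac (obl_x p)"
  proof -
    have "obl_x p - i \<le> obl_y p - j" using that by (simp add: frac_def i_def j_def)
    then have "real_of_int (i - j) < real_of_int (int b + 1)" "real_of_int (j - i) < real_of_int (int c)"
      using p' fl by auto
    then show ?thesis by linarith
  qed
  ultimately show ?thesis by (simp add: cell_at_def flip: i_def j_def)
qed

lemma generic_in_hexagon_iff:
  assumes "a > 0" "b > 0" "c > 0" "generic p"
  shows "p \<in> hexagon a b c \<longleftrightarrow> in_hex a b c (cell_at p)"
proof
  assume "in_hex a b c (cell_at p)"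
  then show "p \<in> hexagon a b c"
    using region_subset_hexagon[OF assms(1-3)] generic_in_region_iff[OF assms(4)] by blast
qed (rule generic_in_hexagon[OF assms])

text \<open>The union is closed and contains all generic points of the hexagon, which are dense in it because the
  hexagon is the closure of its interior.\<close>

lemma hexagon_eq_Union_regions:
  assumes "a > 0" "b > 0" "c > 0"
  shows "hexagon a b c = (\<Union>s\<in>{s. in_hex a b c s}. region s)" (is "_ = ?U")
proof (intro equalityI subsetI)
  fix p assume p: "p \<in> hexagon a b c"
  have "closed (region s)" for s
    unfolding convex_hull_corners[symmetric]
    by (cases s) (auto intro!: compact_imp_closed finite_imp_compact_convex_hull)
  then have closed: "closed ?U" by (intro closed_UN finite_in_hex) auto
  have "in_hex a b c (Below 0 0)" using assms by simp
  then have "interior (region (Below 0 0)) \<subseteq> interior (hexagon a b c)"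
    by (intro interior_mono region_subset_hexagon assms)
  moreover obtain q where "generic q" "cell_at q = Below 0 0" by (rule obtain_generic_in_cell)
  ultimately have "interior (hexagon a b c) \<noteq> {}" using generic_in_interior by fastforce
  moreover have "convex (hexagon a b c)" by (simp add: hexagon_def)
  ultimately have closure: "p \<in> closure (interior (hexagon a b c))"
    using p convex_closure_interior closure_subset by blast
  show "p \<in> ?U"
  proof (rule ccontr)
    assume "p \<notin> ?U"
    then have "(- ?U) \<inter> interior (hexagon a b c) \<noteq> {}"
      using closure closed by (meson ComplI closure_iff_nhds_not_empty disjoint_iff open_Compl subset_refl)
    moreover have "open ((- ?U) \<inter> interior (hexagon a b c))"
      by (intro open_Int open_Compl closed open_interior)
    ultimately obtain q where q: "q \<in> (- ?U) \<inter> interior (hexagon a b c)" "generic q"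
      using open_contains_generic by metis
    then have "in_hex a b c (cell_at q)"
      using generic_in_hexagon[OF assms] interior_subset by blast
    then show False using q generic_in_region_iff by blast
  qed
qed (use region_subset_hexagon[OF assms] in auto)

definition matchings :: "nat \<Rightarrow> nat \<Rightarrow> nat \<Rightarrow> tile set set" where
  "matchings a b c = {M. (\<forall>t\<in>M. \<forall>s\<in>cells_of t. in_hex a b c s) \<and>
     (\<forall>s. in_hex a b c s \<longrightarrow> (\<exists>!t. t \<in> M \<and> s \<in> cells_of t))}"

lemma matchings_in_hex: "\<lbrakk>M \<in> matchings a b c; t \<in> M; s \<in> cells_of t\<rbrakk> \<Longrightarrow> in_hex a b c s"
  by (simp add: matchings_def)

lemma matchings_cover:
  assumes "M \<in> matchings a b c" "in_hex a b c s"
  obtains t where "t \<in> M" "s \<in> cells_of t"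
  using assms by (auto simp: matchings_def dest!: ex1_implies_ex)

lemma matchings_unique:
  assumes "M \<in> matchings a b c" "t \<in> M" "u \<in> M" "s \<in> cells_of t" "s \<in> cells_of u"
  shows "t = u"
proof -
  have "\<exists>!t. t \<in> M \<and> s \<in> cells_of t"
    using assms(1) matchings_in_hex[OF assms(1,2,4)] by (simp add: matchings_def)
  then show ?thesis using assms(2-5) by blast
qed

text \<open>Generic points serve as test points: a generic point of a unit triangle lies in a lozenge if and only if the
  lozenge contains the triangle, and then it is an interior point of the lozenge. So covering the hexagon
  with disjoint interiors means that each triangle is in exactly one lozenge.\<close>

lemma bij_betw_matchings_tilings:
  assumes "a > 0" "b > 0" "c > 0"
  shows "bij_betw ((`) lozenge_of) (matchings a b c) (lozenge_tilings a b c)"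
  unfolding bij_betw_def
proof (intro conjI equalityI subsetI)
  show "inj_on ((`) lozenge_of) (matchings a b c)"
    using inj_lozenge_of by (auto intro!: inj_onI simp: inj_image_eq_iff)
next
  fix T assume "T \<in> (`) lozenge_of ` matchings a b c"
  then obtain M where TM: "T = lozenge_of ` M" and M: "M \<in> matchings a b c" by blast
  have "\<Union> (lozenge_of ` M) = (\<Union>s\<in>{s. in_hex a b c s}. region s)"
  proof (intro equalityI subsetI)
    fix p assume "p \<in> \<Union> (lozenge_of ` M)"
    then obtain t s where "t \<in> M" "s \<in> cells_of t" "p \<in> region s" unfolding lozenge_of_def by blast
    then show "p \<in> (\<Union>s\<in>{s. in_hex a b c s}. region s)" using matchings_in_hex[OF M] by blast
  next
    fix p assume "p \<in> (\<Union>s\<in>{s. in_hex a b c s}. region s)"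
    then obtain s where "in_hex a b c s" "p \<in> region s" by blast
    moreover from this obtain t where "t \<in> M" "s \<in> cells_of t" using matchings_cover[OF M] by blast
    ultimately show "p \<in> \<Union> (lozenge_of ` M)" unfolding lozenge_of_def by blast
  qed
  moreover have "pairwise (\<lambda>s t. interior s \<inter> interior t = {}) (lozenge_of ` M)"
    unfolding pairwise_def
  proof (intro ballI impI, rule ccontr)
    fix r s assume rs: "r \<in> lozenge_of ` M" "s \<in> lozenge_of ` M" "r \<noteq> s" "interior r \<inter> interior s \<noteq> {}"
    obtain t u where tu: "r = lozenge_of t" "s = lozenge_of u" "t \<in> M" "u \<in> M" using rs by blast
    have "open (interior r \<inter> interior s)" by auto
    then obtain p where p: "p \<in> interior r \<inter> interior s" "generic p"
      using rs(4) open_contains_generic by metis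
    then have "p \<in> lozenge_of t" "p \<in> lozenge_of u" using tu interior_subset by blast+
    then have "cell_at p \<in> cells_of t" "cell_at p \<in> cells_of u" using generic_in_lozenge_of_iff p(2) by auto
    then have "t = u" using matchings_unique[OF M] tu(3,4) by blast
    then show False using rs(3) tu by simp
  qed
  ultimately show "T \<in> lozenge_tilings a b c"
    unfolding lozenge_tilings_def TM lozenges_eq hexagon_eq_Union_regions[OF assms] by blast
next
  fix T assume T: "T \<in> lozenge_tilings a b c"
  define M where "M = {t. lozenge_of t \<in> T}"
  have TM: "T = lozenge_of ` M" using T by (auto simp: M_def lozenge_tilings_def lozenges_eq)
  have "in_hex a b c s" if "t \<in> M" "s \<in> cells_of t" for t s
  proof -
    obtain p where p: "generic p" "cell_at p = s" by (rule obtain_generic_in_cell)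
    then have "p \<in> hexagon a b c"
      using T that generic_in_lozenge_of_iff[of p t] by (auto simp: M_def lozenge_tilings_def)
    then show ?thesis using generic_in_hexagon[OF assms] p by blast
  qed
  moreover have "\<exists>!t. t \<in> M \<and> s \<in> cells_of t" if s: "in_hex a b c s" for s
  proof -
    obtain p where p: "generic p" "cell_at p = s" by (rule obtain_generic_in_cell)
    then have "p \<in> hexagon a b c" using s generic_in_hexagon_iff[OF assms] by blast
    moreover have "\<Union> T = hexagon a b c" using T by (simp add: lozenge_tilings_def)
    ultimately obtain t where t: "t \<in> M" "p \<in> lozenge_of t" unfolding TM by blast
    have "u = t" if u: "u \<in> M" "s \<in> cells_of u" for u
    proof (rule ccontr)
      assume "u \<noteq> t"
      then have "lozenge_of u \<noteq> lozenge_of t" using inj_lozenge_of by (auto dest: injD)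
      moreover have "p \<in> interior (lozenge_of u)" "p \<in> interior (lozenge_of t)"
        using p t u by (auto intro!: generic_in_interior_lozenge_of simp: generic_in_lozenge_of_iff)
      ultimately show False
        using T t u unfolding lozenge_tilings_def pairwise_def M_def by blast
    qed
    moreover have "s \<in> cells_of t" using t p by (auto simp: generic_in_lozenge_of_iff)
    ultimately show ?thesis using t(1) by blast
  qed
  ultimately have "M \<in> matchings a b c" by (simp add: matchings_def)
  then show "T \<in> (`) lozenge_of ` matchings a b c" using TM by blast
qed

section \<open>Matchings as height functions\<close>

text \<open>\<open>H i j\<close> is the height at the lattice point \<open>(i, j)\<close>, for \<open>0 \<le> i \<le> a + b\<close> and \<open>0 \<le> j \<le> c + i\<close>. This is the
  trapezoid that arises from the hexagon by adding the two triangular corners that are filled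
  with horizontal lozenges. The assumptions prescribe the heights at both ends of each line and on the
  last line; those on the rest of the boundary of the hexagon follow, see \<open>frozen_below\<close>,
  \<open>frozen_above\<close> and \<open>left\<close>.\<close>

locale height_function =
  fixes a b c :: nat and H :: "nat \<Rightarrow> nat \<Rightarrow> nat"
  assumes flat_edge: "\<lbrakk>i < a + b; j \<le> c + i\<rbrakk> \<Longrightarrow> H i j \<le> H (Suc i) j"
    and diag_edge: "\<lbrakk>i < a + b; j \<le> c + i\<rbrakk> \<Longrightarrow> H (Suc i) (Suc j) \<le> Suc (H i j)"
    and ver_edge: "\<lbrakk>i \<le> a + b; j < c + i\<rbrakk> \<Longrightarrow> H i j \<le> H i (Suc j) \<and> H i (Suc j) \<le> Suc (H i j)"
    and bottom: "i \<le> a + b \<Longrightarrow> H i 0 = 0"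
    and top: "i \<le> a + b \<Longrightarrow> H i (c + i) = i"
    and right: "j \<le> c + (a + b) \<Longrightarrow> H (a + b) j = (if j \<le> a then j else if j \<le> a + c then a else j - c)"
begin

lemma mono:
  assumes "i \<le> a + b" "j \<le> k" "k \<le> c + i"
  shows "H i j \<le> H i k"
  using assms(2,3)
proof (induction k rule: dec_induct)
  case (step k)
  then have "H i j \<le> H i k" "H i k \<le> H i (Suc k)" using ver_edge[of i k] assms(1) by auto
  then show ?case by simp
qed simp

lemma increase_le:
  assumes "i \<le> a + b" "j \<le> k" "k \<le> c + i"
  shows "H i k \<le> H i j + (k - j)"
  using assms(2,3)
proof (induction k rule: dec_induct)
  case (step k)
  then have "H i k \<le> H i j + (k - j)" "H i (Suc k) \<le> Suc (H i k)" using ver_edge[of i k] assms(1) by auto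
  then show ?case using step.hyps by simp
qed simp

text \<open>The lower bound descends from the last line along \<open>e1 + e2\<close>-edges, on which the height grows by at most 1; the
  upper bound holds because the height starts at 0 on each line.\<close>

lemma frozen_below:
  assumes "i \<le> a + b" "j + b \<le> i"
  shows "H i j = j"
  using assms
proof (induction i arbitrary: j rule: inc_induct)
  case base
  then show ?case by (simp add: right)
next
  case (step i)
  have "Suc j \<le> Suc (H i j)" using step.IH[of "Suc j"] step diag_edge[of i j] by simp
  moreover have "H i j \<le> j" using increase_le[of i 0 j] bottom[of i] step by simp
  ultimately show ?case by simp
qed

text \<open>The \<open>e1\<close>-edges bound the height from above by its value on the last line; the end \<open>H i (c + i) = i\<close> of
  line \<open>i\<close> bounds it from below.\<close>

lemma frozen_above:
  assumes "i \<le> a + b" "a + c \<le> j" "j \<le> c + i"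
  shows "H i j = j - c"
  using assms
proof (induction i rule: inc_induct)
  case base
  then show ?case by (simp add: right)
next
  case (step i)
  have "H i j \<le> j - c" using step.IH step flat_edge[of i j] by simp
  moreover have "i \<le> H i j + (c + i - j)" using increase_le[of i j "c + i"] top[of i] step by simp
  ultimately show ?case using step by simp
qed

lemma left: "j \<le> c \<Longrightarrow> H 0 j = 0"
  using mono[of 0 j c] top[of 0] by simp

lemma le_row: "\<lbrakk>i \<le> a + b; j \<le> c + i\<rbrakk> \<Longrightarrow> H i j \<le> i"
  using mono[of i j "c + i"] top[of i] by simp

end

text \<open>Whether the lozenge across an edge is present, in terms of the heights at the ends of the edge.\<close>

fun straddled :: "(nat \<Rightarrow> nat \<Rightarrow> nat) \<Rightarrow> tile \<Rightarrow> bool" where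
  "straddled H (Ver i j) \<longleftrightarrow> H (nat i) (Suc (nat j)) \<noteq> H (nat i) (nat j)"
| "straddled H (Flat i j) \<longleftrightarrow> H (Suc (nat i)) (nat j) \<noteq> H (nat i) (nat j)"
| "straddled H (Diag i j) \<longleftrightarrow> H (Suc (nat i)) (Suc (nat j)) = H (nat i) (nat j)"

definition tiles_of_height :: "nat \<Rightarrow> nat \<Rightarrow> nat \<Rightarrow> (nat \<Rightarrow> nat \<Rightarrow> nat) \<Rightarrow> tile set" where
  "tiles_of_height a b c H = {t. (\<forall>s\<in>cells_of t. in_hex a b c s) \<and> straddled H t}"

lemma Below_in_cells_of_iff: "Below i j \<in> cells_of t \<longleftrightarrow> t = Ver (i + 1) j \<or> t = Flat i j \<or> t = Diag i j"
  by (cases t) auto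

lemma Above_in_cells_of_iff: "Above i j \<in> cells_of t \<longleftrightarrow> t = Ver i j \<or> t = Flat i (j + 1) \<or> t = Diag i j"
  by (cases t) auto

lemma tiles_of_height_cong:
  assumes "\<And>i j. \<lbrakk>i \<le> a + b; j \<le> c + i\<rbrakk> \<Longrightarrow> H i j = H' i j"
  shows "tiles_of_height a b c H = tiles_of_height a b c H'"
proof -
  have "straddled H t = straddled H' t" if "\<forall>s\<in>cells_of t. in_hex a b c s" for t
    using that by (cases t) (auto simp: assms nat_le_iff Suc_le_eq nat_less_iff)
  then show ?thesis by (auto simp: tiles_of_height_def)
qed

lemma ex1_one_of_three:
  assumes "P u \<and> \<not> P v \<and> \<not> P w \<or> \<not> P u \<and> P v \<and> \<not> P w \<or> \<not> P u \<and> \<not> P v \<and> P w"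
  shows "\<exists>!t. P t \<and> (t = u \<or> t = v \<or> t = w)"
  using assms by (elim disjE) blast+

text \<open>In a triangle, the differences along the vertical edge and the \<open>e1\<close>-edge add up to that along the
  \<open>e1 + e2\<close>-edge, and all three are 0 or 1. So either one of the first two is 1 and the last is
  1, or all are 0: exactly one edge of the triangle is straddled. The heights on the boundary ensure
  that the straddling lozenge stays in the hexagon.\<close>

lemma (in height_function) tiles_of_height_in_matchings: "tiles_of_height a b c H \<in> matchings a b c"
proof -
  let ?M = "tiles_of_height a b c H"
  have "\<exists>!t. t \<in> ?M \<and> s \<in> cells_of t" if s: "in_hex a b c s" for s
  proof (cases s)
    case (Below i' j')
    define i j where "i = nat i'" and "j = nat j'"
    have ij: "i' = int i" "j' = int j" using s Below by (simp_all add: i_def j_def)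
    have hex: "i < a + b" "j < a + c" "i < b + j" "j \<le> c + i" using s by (auto simp: Below ij)
    have steps: "H i j \<le> H (Suc i) j" "H (Suc i) j \<le> H (Suc i) (Suc j)" "H (Suc i) (Suc j) \<le> Suc (H i j)"
      using flat_edge[of i j] diag_edge[of i j] ver_edge[of "Suc i" j] hex by auto
    have Ver: "Ver (i' + 1) j' \<in> ?M \<longleftrightarrow> H (Suc i) (Suc j) \<noteq> H (Suc i) j"
    proof -
      have "Suc i < a + b" if "H (Suc i) (Suc j) \<noteq> H (Suc i) j"
      proof (rule ccontr)
        assume "\<not> Suc i < a + b"
        then have "Suc i = a + b" using hex by simp
        then show False using that hex right[of j] right[of "Suc j"] by (auto split: if_splits)
      qed
      then show ?thesis using hex by (auto simp: tiles_of_height_def ij nat_add_distrib)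
    qed
    have Flat: "Flat i' j' \<in> ?M \<longleftrightarrow> H (Suc i) j \<noteq> H i j"
    proof -
      have "0 < j" if "H (Suc i) j \<noteq> H i j"
        using that bottom[of i] bottom[of "Suc i"] hex by (cases j) auto
      then show ?thesis using hex by (auto simp: tiles_of_height_def ij)
    qed
    have Diag: "Diag i' j' \<in> ?M \<longleftrightarrow> H (Suc i) (Suc j) = H i j"
    proof -
      have "j < c + i" if "H (Suc i) (Suc j) = H i j"
      proof (rule ccontr)
        assume "\<not> j < c + i"
        then have "j = c + i" using hex by simp
        then show False using that hex top[of i] top[of "Suc i"] by simp
      qed
      then show ?thesis using hex by (auto simp: tiles_of_height_def ij)
    qed
    show ?thesis
      unfolding Below Below_in_cells_of_iff
      by (rule ex1_one_of_three, unfold Ver Flat Diag) (use steps in linarith)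
  next
    case (Above i' j')
    define i j where "i = nat i'" and "j = nat j'"
    have ij: "i' = int i" "j' = int j" using s Above by (simp_all add: i_def j_def)
    have hex: "i < a + b" "j < a + c" "i \<le> b + j" "j < c + i" using s by (auto simp: Above ij)
    have steps: "H i j \<le> H i (Suc j)" "H i (Suc j) \<le> H (Suc i) (Suc j)" "H (Suc i) (Suc j) \<le> Suc (H i j)"
      using flat_edge[of i "Suc j"] diag_edge[of i j] ver_edge[of i j] hex by auto
    have Ver: "Ver i' j' \<in> ?M \<longleftrightarrow> H i (Suc j) \<noteq> H i j"
    proof -
      have "0 < i" if "H i (Suc j) \<noteq> H i j"
        using that left[of j] left[of "Suc j"] hex by (cases i) auto
      then show ?thesis using hex by (auto simp: tiles_of_height_def ij)
    qed
    have Flat: "Flat i' (j' + 1) \<in> ?M \<longleftrightarrow> H (Suc i) (Suc j) \<noteq> H i (Suc j)"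
    proof -
      have "Suc j < a + c" if "H (Suc i) (Suc j) \<noteq> H i (Suc j)"
      proof (rule ccontr)
        assume "\<not> Suc j < a + c"
        then have "Suc j = a + c" using hex by simp
        then show False using that hex frozen_above[of i "Suc j"] frozen_above[of "Suc i" "Suc j"] by simp
      qed
      then show ?thesis using hex by (auto simp: tiles_of_height_def ij nat_add_distrib)
    qed
    have Diag: "Diag i' j' \<in> ?M \<longleftrightarrow> H (Suc i) (Suc j) = H i j"
    proof -
      have "i < b + j" if "H (Suc i) (Suc j) = H i j"
      proof (rule ccontr)
        assume "\<not> i < b + j"
        then show False using that hex frozen_below[of i j] frozen_below[of "Suc i" "Suc j"] by simp
      qed
      then show ?thesis using hex by (auto simp: tiles_of_height_def ij)
    qed
    show ?thesis
      unfolding Above Above_in_cells_of_iff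
      by (rule ex1_one_of_three, unfold Ver Flat Diag) (use steps in linarith)
  qed
  then show ?thesis by (auto simp: matchings_def tiles_of_height_def)
qed

definition horizontal_or_frozen :: "nat \<Rightarrow> nat \<Rightarrow> nat \<Rightarrow> tile set \<Rightarrow> nat \<Rightarrow> nat \<Rightarrow> bool" where
  "horizontal_or_frozen a b c M i j \<longleftrightarrow> j + b < i \<or> a + c \<le> j \<or> Ver (int i) (int j) \<in> M"

definition height_of_matching :: "nat \<Rightarrow> nat \<Rightarrow> nat \<Rightarrow> tile set \<Rightarrow> nat \<Rightarrow> nat \<Rightarrow> nat" where
  "height_of_matching a b c M i y = (\<Sum>j<y. of_bool (horizontal_or_frozen a b c M i j))"

text \<open>One equation for each triangle of the trapezoid: exactly one of its three edges is straddled. A triangle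
  outside the hexagon is covered by an added horizontal lozenge.\<close>

lemma matching_around_Below:
  assumes M: "M \<in> matchings a b c" and ij: "i < a + b" "j \<le> c + i"
  shows "of_bool (Flat (int i) (int j) \<in> M) + of_bool (horizontal_or_frozen a b c M (Suc i) j) +
    of_bool (Diag (int i) (int j) \<in> M) = (1::nat)"
proof (cases "in_hex a b c (Below (int i) (int j))")
  case True
  then have hf: "horizontal_or_frozen a b c M (Suc i) j \<longleftrightarrow> Ver (int i + 1) (int j) \<in> M"
    by (auto simp: horizontal_or_frozen_def add.commute)
  obtain t where t: "t \<in> M" "Below (int i) (int j) \<in> cells_of t" using matchings_cover[OF M True] .
  have "u = t" if "u \<in> M" "Below (int i) (int j) \<in> cells_of u" for u
    using matchings_unique[OF M that(1) t(1) that(2) t(2)] .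
  then have "t = Ver (int i + 1) (int j) \<or> t = Flat (int i) (int j) \<or> t = Diag (int i) (int j)"
    "Ver (int i + 1) (int j) \<in> M \<longleftrightarrow> t = Ver (int i + 1) (int j)"
    "Flat (int i) (int j) \<in> M \<longleftrightarrow> t = Flat (int i) (int j)"
    "Diag (int i) (int j) \<in> M \<longleftrightarrow> t = Diag (int i) (int j)"
    using t unfolding Below_in_cells_of_iff by blast+
  then show ?thesis unfolding hf by (elim disjE) simp_all
next
  case False
  then have "j + b < Suc i \<or> a + c \<le> j" using ij by auto
  moreover have "Flat (int i) (int j) \<notin> M" "Diag (int i) (int j) \<notin> M"
    using matchings_in_hex[OF M] False by force+
  ultimately show ?thesis by (auto simp: horizontal_or_frozen_def)
qed

lemma matching_around_Above:
  assumes M: "M \<in> matchings a b c" and ij: "i < a + b" "j < c + i"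
  shows "of_bool (Flat (int i) (int (Suc j)) \<in> M) + of_bool (horizontal_or_frozen a b c M i j) +
    of_bool (Diag (int i) (int j) \<in> M) = (1::nat)"
proof (cases "in_hex a b c (Above (int i) (int j))")
  case True
  then have hf: "horizontal_or_frozen a b c M i j \<longleftrightarrow> Ver (int i) (int j) \<in> M"
    by (auto simp: horizontal_or_frozen_def)
  have suc: "int (Suc j) = int j + 1" by simp
  obtain t where t: "t \<in> M" "Above (int i) (int j) \<in> cells_of t" using matchings_cover[OF M True] .
  have "u = t" if "u \<in> M" "Above (int i) (int j) \<in> cells_of u" for u
    using matchings_unique[OF M that(1) t(1) that(2) t(2)] .
  then have "t = Ver (int i) (int j) \<or> t = Flat (int i) (int j + 1) \<or> t = Diag (int i) (int j)"
    "Ver (int i) (int j) \<in> M \<longleftrightarrow> t = Ver (int i) (int j)"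
    "Flat (int i) (int j + 1) \<in> M \<longleftrightarrow> t = Flat (int i) (int j + 1)"
    "Diag (int i) (int j) \<in> M \<longleftrightarrow> t = Diag (int i) (int j)"
    using t unfolding Above_in_cells_of_iff by blast+
  then show ?thesis unfolding hf suc by (elim disjE) simp_all
next
  case False
  then have "j + b < i \<or> a + c \<le> j" using ij by auto
  moreover have "Flat (int i) (int (Suc j)) \<notin> M" "Diag (int i) (int j) \<notin> M"
    using matchings_in_hex[OF M] False by force+
  ultimately show ?thesis by (auto simp: horizontal_or_frozen_def)
qed

lemma height_of_matching_Suc:
  "height_of_matching a b c M i (Suc y) =
    height_of_matching a b c M i y + of_bool (horizontal_or_frozen a b c M i y)"
  by (simp add: height_of_matching_def)

lemma height_of_matching_0: "height_of_matching a b c M i 0 = 0"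
  by (simp add: height_of_matching_def)

text \<open>Going up the strip between two lines, the equations of its triangles propagate the claim from one \<open>e1\<close>-edge
  to the next. At the bottom no lozenge fits.\<close>

lemma height_of_matching_flat_edge:
  assumes M: "M \<in> matchings a b c" and "i < a + b" "j \<le> c + i"
  shows "height_of_matching a b c M (Suc i) j =
    height_of_matching a b c M i j + of_bool (Flat (int i) (int j) \<in> M)"
  using assms(3)
proof (induction j)
  case 0
  have "Flat (int i) 0 \<notin> M" using matchings_in_hex[OF M, of "Flat (int i) 0" "Above (int i) (- 1)"] by auto
  then show ?case by (simp add: height_of_matching_0)
next
  case (Suc j)
  then have "of_bool (Flat (int i) (int j) \<in> M) + of_bool (horizontal_or_frozen a b c M (Suc i) j) =
    of_bool (horizontal_or_frozen a b c M i j) + (of_bool (Flat (int i) (int (Suc j)) \<in> M) :: nat)"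
    using matching_around_Below[OF M assms(2), of j] matching_around_Above[OF M assms(2), of j] by linarith
  then show ?case using Suc by (simp add: height_of_matching_Suc)
qed

lemma height_of_matching_diag_edge:
  assumes M: "M \<in> matchings a b c" and "i < a + b" "j \<le> c + i"
  shows "height_of_matching a b c M (Suc i) (Suc j) + of_bool (Diag (int i) (int j) \<in> M) =
    height_of_matching a b c M i j + 1"
  using height_of_matching_flat_edge[OF assms] matching_around_Below[OF assms]
  by (simp add: height_of_matching_Suc)

lemma height_function_of_matching:
  assumes M: "M \<in> matchings a b c"
  shows "height_function a b c (height_of_matching a b c M)"
proof
  fix i j :: nat
  assume "i < a + b" "j \<le> c + i"
  then show "height_of_matching a b c M i j \<le> height_of_matching a b c M (Suc i) j"
    using height_of_matching_flat_edge[OF M] by simp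
next
  fix i j :: nat
  assume "i < a + b" "j \<le> c + i"
  then show "height_of_matching a b c M (Suc i) (Suc j) \<le> Suc (height_of_matching a b c M i j)"
    using height_of_matching_diag_edge[OF M] by (metis Suc_eq_plus1 le_add1)
next
  fix i j :: nat
  show "height_of_matching a b c M i j \<le> height_of_matching a b c M i (Suc j) \<and>
      height_of_matching a b c M i (Suc j) \<le> Suc (height_of_matching a b c M i j)"
    by (simp add: height_of_matching_Suc)
next
  fix i :: nat
  show "height_of_matching a b c M i 0 = 0" by (rule height_of_matching_0)
next
  fix i :: nat
  assume "i \<le> a + b"
  then show "height_of_matching a b c M i (c + i) = i"
  proof (induction i)
    case 0
    have "\<not> horizontal_or_frozen a b c M 0 j" if "j < c" for j
      using that matchings_in_hex[OF M, of "Ver 0 (int j)" "Below (- 1) (int j)"]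
      by (auto simp: horizontal_or_frozen_def)
    then show ?case by (simp add: height_of_matching_def)
  next
    case (Suc i)
    \<comment> \<open>Such a tile would leave the hexagon through its upper left side.\<close>
    have "Diag (int i) (int (c + i)) \<notin> M"
      using matchings_in_hex[OF M, of "Diag (int i) (int (c + i))" "Above (int i) (int (c + i))"] by auto
    then show ?case using height_of_matching_diag_edge[OF M, of i "c + i"] Suc by simp
  qed
next
  fix j :: nat
  have hf: "horizontal_or_frozen a b c M (a + b) k \<longleftrightarrow> k < a \<or> a + c \<le> k" for k
    using matchings_in_hex[OF M, of "Ver (int (a + b)) (int k)" "Above (int (a + b)) (int k)"]
    by (auto simp: horizontal_or_frozen_def)
  show "height_of_matching a b c M (a + b) j = (if j \<le> a then j else if j \<le> a + c then a else j - c)"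
    by (induction j) (auto simp: height_of_matching_0 height_of_matching_Suc hf)
qed

lemma tiles_of_height_of_matching:
  assumes M: "M \<in> matchings a b c"
  shows "tiles_of_height a b c (height_of_matching a b c M) = M"
proof -
  let ?H = "height_of_matching a b c M"
  have "straddled ?H t \<longleftrightarrow> t \<in> M" if t: "\<forall>s\<in>cells_of t. in_hex a b c s" for t
  proof (cases t)
    case (Ver i j)
    then show ?thesis using t
      by (auto simp: height_of_matching_Suc horizontal_or_frozen_def)
  next
    case (Flat i j)
    then show ?thesis using t height_of_matching_flat_edge[OF M, of "nat i" "nat j"]
      by (auto simp: nat_less_iff nat_le_iff)
  next
    case (Diag i j)
    then show ?thesis using t height_of_matching_diag_edge[OF M, of "nat i" "nat j"]
      by (auto simp: nat_less_iff nat_le_iff of_bool_def split: if_splits)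
  qed
  then show ?thesis using matchings_in_hex[OF M] by (auto simp: tiles_of_height_def)
qed

section \<open>Height functions as Gelfand-Tsetlin patterns\<close>

definition top_row :: "nat \<Rightarrow> nat \<Rightarrow> nat \<Rightarrow> nat \<Rightarrow> nat" where
  "top_row a b c = restrict (\<lambda>k. if k < a then k else k + c) {..<a + b}"

definition pattern_height :: "(nat \<Rightarrow> nat \<Rightarrow> nat) \<Rightarrow> nat \<Rightarrow> nat \<Rightarrow> nat" where
  "pattern_height p i y = card {k. k < i \<and> p i k < y}"

lemma strict_mono_top_row: "strict_mono_on {..<a + b} (top_row a b c)"
  by (rule strict_mono_onI) (auto simp: top_row_def)

lemma gt_patterns_interlace:
  assumes "p \<in> gt_patterns n l" "i < n" "k < i"
  shows "p (Suc i) k \<le> p i k" "p i k < p (Suc i) (Suc k)"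
  using assms by (auto simp: gt_patterns_def interlacing_def PiE_iff)

lemma gt_patterns_strict_mono:
  assumes "p \<in> gt_patterns n l" "strict_mono_on {..<n} l" "i \<le> n"
  shows "strict_mono_on {..<i} (p i)"
  using assms(3)
proof (induction i rule: inc_induct)
  case base
  then show ?case using assms(1,2) by (simp add: gt_patterns_def)
next
  case (step i)
  then have "p i \<in> interlacing i (p (Suc i))" using assms(1) by (simp add: gt_patterns_def)
  then show ?case using strict_mono_interlacing step.IH by blast
qed

lemma gt_patterns_le:
  assumes p: "p \<in> gt_patterns n l" and l: "\<And>k. k < n \<Longrightarrow> l k \<le> k + c" and "i \<le> n" "k < i"
  shows "p i k \<le> k + c"
  using assms(3,4)
proof (induction i arbitrary: k rule: inc_induct)
  case base
  then show ?case using p l by (simp add: gt_patterns_def)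
next
  case (step i)
  then have "p i k < p (Suc i) (Suc k)" "p (Suc i) (Suc k) \<le> Suc k + c"
    using gt_patterns_interlace(2)[OF p, of i k] step.IH[of "Suc k"] by auto
  then show ?case by simp
qed

lemma pattern_entry_less:
  assumes "p \<in> gt_patterns (a + b) (top_row a b c)" "i \<le> a + b" "k < i"
  shows "p i k < c + i"
proof -
  have "top_row a b c k \<le> k + c" if "k < a + b" for k using that by (simp add: top_row_def)
  then have "p i k \<le> k + c" using gt_patterns_le[OF assms(1) _ assms(2,3)] by blast
  then show ?thesis using assms(3) by simp
qed

lemma strict_mono_on_bounded_count_Suc:
  assumes "strict_mono_on {..<i} (r :: nat \<Rightarrow> nat)"
  shows "card {k. k < i \<and> r k < Suc y} = card {k. k < i \<and> r k < y} + of_bool (y \<in> r ` {..<i})"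
proof (cases "y \<in> r ` {..<i}")
  case True
  then obtain k where k: "k < i" "r k = y" by auto
  have "{k. k < i \<and> r k < Suc y} = insert k {k. k < i \<and> r k < y}"
    using k strict_mono_on_imp_inj_on[OF assms] by (auto simp: less_Suc_eq inj_on_def)
  then show ?thesis using k True by simp
next
  case False
  then have "{k. k < i \<and> r k < Suc y} = {k. k < i \<and> r k < y}" by (auto simp: less_Suc_eq)
  then show ?thesis using False by simp
qed

text \<open>The two halves \<open>p (i + 1) k \<le> p i k\<close> and \<open>p i k < p (i + 1) (k + 1)\<close> of interlacing are the bounds along
  \<open>e1\<close>- and \<open>e1 + e2\<close>-edges, read off by counting the entries below a point.\<close>

lemma height_function_of_pattern:
  assumes p: "p \<in> gt_patterns (a + b) (top_row a b c)"
  shows "height_function a b c (pattern_height p)"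
proof
  fix i j :: nat
  assume "i < a + b"
  then have "{k. k < i \<and> p i k < j} \<subseteq> {k. k < Suc i \<and> p (Suc i) k < j}"
    using gt_patterns_interlace(1)[OF p] by (auto intro: le_less_trans)
  then show "pattern_height p i j \<le> pattern_height p (Suc i) j"
    unfolding pattern_height_def by (intro card_mono) auto
next
  fix i j :: nat
  assume i: "i < a + b"
  have "{k. k < Suc i \<and> p (Suc i) k < Suc j} \<subseteq> insert 0 (Suc ` {k. k < i \<and> p i k < j})"
  proof
    fix k assume k: "k \<in> {k. k < Suc i \<and> p (Suc i) k < Suc j}"
    show "k \<in> insert 0 (Suc ` {k. k < i \<and> p i k < j})"
    proof (cases k)
      case (Suc k')
      then have "p i k' < j" using gt_patterns_interlace(2)[OF p i, of k'] k by auto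
      then show ?thesis using Suc k by auto
    qed simp
  qed
  then have "pattern_height p (Suc i) (Suc j) \<le> card (insert 0 (Suc ` {k. k < i \<and> p i k < j}))"
    unfolding pattern_height_def by (intro card_mono) auto
  also have "\<dots> \<le> Suc (card (Suc ` {k. k < i \<and> p i k < j}))" by (simp add: card_insert_if)
  also have "card (Suc ` {k. k < i \<and> p i k < j}) = pattern_height p i j"
    unfolding pattern_height_def by (simp add: card_image)
  finally show "pattern_height p (Suc i) (Suc j) \<le> Suc (pattern_height p i j)" .
next
  fix i j :: nat
  assume "i \<le> a + b"
  then show "pattern_height p i j \<le> pattern_height p i (Suc j) \<and>
      pattern_height p i (Suc j) \<le> Suc (pattern_height p i j)"
    unfolding pattern_height_def
      strict_mono_on_bounded_count_Suc[OF gt_patterns_strict_mono[OF p strict_mono_top_row \<open>i \<le> a + b\<close>]]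
    by simp
next
  fix i :: nat
  show "pattern_height p i 0 = 0" by (simp add: pattern_height_def)
next
  fix i :: nat
  assume i: "i \<le> a + b"
  have "p i k < c + i" if "k < i" for k using pattern_entry_less[OF p i that] .
  then have "{k. k < i \<and> p i k < c + i} = {..<i}" by auto
  then show "pattern_height p i (c + i) = i" by (simp add: pattern_height_def)
next
  fix j :: nat
  assume j: "j \<le> c + (a + b)"
  have "p (a + b) = top_row a b c" using p by (simp add: gt_patterns_def)
  then have "{k. k < a + b \<and> p (a + b) k < j} = {..<if j \<le> a then j else if j \<le> a + c then a else j - c}"
    using j by (auto simp: top_row_def split: if_splits)
  then show "pattern_height p (a + b) j = (if j \<le> a then j else if j \<le> a + c then a else j - c)"
    by (simp add: pattern_height_def)
qed

text \<open>The position of the step at which the height on line \<open>i\<close> rises from \<open>k\<close> to \<open>k + 1\<close>.\<close>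

definition pattern_of_height :: "nat \<Rightarrow> (nat \<Rightarrow> nat \<Rightarrow> nat) \<Rightarrow> nat \<Rightarrow> nat \<Rightarrow> nat" where
  "pattern_of_height n H i = (if i \<le> n then restrict (\<lambda>k. LEAST y. k < H i (Suc y)) {..<i} else undefined)"

text \<open>A Galois connection between entries and heights, through which interlacing and the bounds on
  height differences translate into each other.\<close>

lemma (in height_function) pattern_of_height_less_iff:
  assumes "i \<le> a + b" "k < i" "y \<le> c + i"
  shows "pattern_of_height (a + b) H i k < y \<longleftrightarrow> k < H i y"
proof -
  define m where "m = (LEAST y. k < H i (Suc y))"
  have m: "pattern_of_height (a + b) H i k = m"
    using assms(1,2) by (simp add: pattern_of_height_def m_def)
  have "k < H i (Suc (c + (i - 1)))" using top[OF assms(1)] assms(2) by simp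
  then have "k < H i (Suc m)" unfolding m_def by (rule LeastI)
  then have "k < H i y" if "m < y" using mono[OF assms(1), of "Suc m" y] that assms(3) by simp
  moreover have "m < y" if k: "k < H i y"
  proof -
    obtain y' where "y = Suc y'" using k bottom[OF assms(1)] by (cases y) auto
    then have "m \<le> y'" unfolding m_def using k by (intro Least_le) simp
    then show ?thesis using \<open>y = Suc y'\<close> by simp
  qed
  ultimately show ?thesis unfolding m by blast
qed

lemma (in height_function) pattern_height_of_height:
  assumes "i \<le> a + b" "y \<le> c + i"
  shows "pattern_height (pattern_of_height (a + b) H) i y = H i y"
proof -
  have "{k. k < i \<and> pattern_of_height (a + b) H i k < y} = {..<H i y}"
    using pattern_of_height_less_iff[OF assms(1) _ assms(2)] le_row[OF assms(1,2)] by auto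
  then show ?thesis by (simp add: pattern_height_def)
qed

lemma (in height_function) pattern_of_height_in_gt_patterns:
  "pattern_of_height (a + b) H \<in> gt_patterns (a + b) (top_row a b c)"
proof -
  let ?p = "pattern_of_height (a + b) H"
  have bound: "?p i k < c + i" if "i \<le> a + b" "k < i" for i k
    using pattern_of_height_less_iff[OF that order.refl] top[OF that(1)] that(2) by simp
  have "?p (a + b) k = top_row a b c k" for k
  proof (cases "k < a + b")
    case True
    define t where "t = top_row a b c k"
    have t: "t = (if k < a then k else k + c)" using True by (simp add: t_def top_row_def)
    have "k < H (a + b) (Suc t)" "\<not> k < H (a + b) t" using True by (auto simp: right t)
    then have "?p (a + b) k < Suc t" "\<not> ?p (a + b) k < t"
      using pattern_of_height_less_iff[OF order.refl True] True t by auto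
    then show ?thesis by (simp add: t_def)
  qed (simp add: pattern_of_height_def top_row_def)
  then have "?p (a + b) = top_row a b c" by (rule ext)
  moreover have "?p i \<in> interlacing i (?p (Suc i))" if i: "i < a + b" for i
    unfolding interlacing_def
  proof (rule PiE_I)
    fix k assume "k \<in> {..<i}"
    then have k: "k < i" by simp
    have iN: "i \<le> a + b" "Suc i \<le> a + b" using i by auto
    define y where "y = ?p i k"
    have y: "y < c + i" using bound[OF iN(1) k] by (simp add: y_def)
    have "k < H i (Suc y)" "\<not> k < H i y"
      using pattern_of_height_less_iff[OF iN(1) k, of "Suc y"] pattern_of_height_less_iff[OF iN(1) k, of y] y
      by (auto simp: y_def)
    then have "k < H (Suc i) (Suc y)" "\<not> Suc k < H (Suc i) (Suc y)"
      using flat_edge[OF i, of "Suc y"] diag_edge[OF i, of y] y by auto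
    then have "?p (Suc i) k < Suc y" "\<not> ?p (Suc i) (Suc k) < Suc y"
      using pattern_of_height_less_iff[OF iN(2), of k "Suc y"] pattern_of_height_less_iff[OF iN(2), of "Suc k" "Suc y"]
        k y by auto
    then show "?p i k \<in> {?p (Suc i) k..<?p (Suc i) (Suc k)}" by (simp add: y_def)
  qed (use i in \<open>simp add: pattern_of_height_def\<close>)
  ultimately show ?thesis by (simp add: gt_patterns_def pattern_of_height_def)
qed

lemma initial_segment_eq:
  assumes "finite (A :: nat set)" "\<And>m n. \<lbrakk>n \<in> A; m \<le> n\<rbrakk> \<Longrightarrow> m \<in> A"
  shows "A = {..<card A}"
proof (cases "A = {}")
  case False
  then have "A = {..Max A}" using assms by (auto intro: Max_in Max_ge)
  then have "A = {..<Suc (Max A)}" by (simp add: lessThan_Suc_atMost)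
  then show ?thesis by (metis card_lessThan)
qed simp

lemma pattern_of_pattern_height:
  assumes p: "p \<in> gt_patterns (a + b) (top_row a b c)"
  shows "pattern_of_height (a + b) (pattern_height p) = p"
proof (intro ext)
  fix i k
  interpret height_function a b c "pattern_height p" by (rule height_function_of_pattern[OF p])
  show "pattern_of_height (a + b) (pattern_height p) i k = p i k" (is "?q = _")
  proof (cases "i \<le> a + b \<and> k < i")
    case True
    then have sm: "strict_mono_on {..<i} (p i)"
      using gt_patterns_strict_mono[OF p strict_mono_top_row] by blast
    have below: "{k'. k' < i \<and> p i k' < y} = {..<pattern_height p i y}" for y
    proof -
      have "{k'. k' < i \<and> p i k' < y} = {..<card {k'. k' < i \<and> p i k' < y}}"
      proof (rule initial_segment_eq)
        show "finite {k'. k' < i \<and> p i k' < y}" by simp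
      next
        fix m n assume "n \<in> {k'. k' < i \<and> p i k' < y}" "m \<le> n"
        then show "m \<in> {k'. k' < i \<and> p i k' < y}"
          using strict_mono_on_imp_mono_on[OF sm] by (force simp: monotone_on_def)
      qed
      then show ?thesis by (simp add: pattern_height_def)
    qed
    have le: "p i k < c + i" using pattern_entry_less[OF p] True by blast
    have "?q < y \<longleftrightarrow> p i k < y" if "y \<le> c + i" for y
      using pattern_of_height_less_iff[of i k y] below[of y] True that by blast
    from this[of "p i k"] this[of "Suc (p i k)"] show ?thesis using le by simp
  next
    case False
    then consider "i > a + b" | "i = a + b" "\<not> k < i" | "i < a + b" "\<not> k < i" by linarith
    then show ?thesis
    proof cases
      case 1
      then show ?thesis using p by (simp add: pattern_of_height_def gt_patterns_def)
    next
      case 2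
      then show ?thesis using p by (auto simp: pattern_of_height_def gt_patterns_def top_row_def)
    next
      case 3
      then have "p i \<in> interlacing i (p (Suc i))" using p by (simp add: gt_patterns_def)
      then have "p i k = undefined" using 3 by (simp add: interlacing_def PiE_def extensional_def)
      then show ?thesis using 3 by (simp add: pattern_of_height_def)
    qed
  qed
qed

text \<open>Inside the hexagon the tiles determine all increments along a line; outside, the heights are forced.\<close>

lemma height_functions_eqI:
  assumes "height_function a b c H" "height_function a b c H'"
    and eq: "tiles_of_height a b c H = tiles_of_height a b c H'"
    and "i \<le> a + b" "y \<le> c + i"
  shows "H i y = H' i y"
  using assms(5)
proof (induction y)
  case 0
  then show ?case using assms(1,2,4) by (simp add: height_function.bottom)
next
  case (Suc y)
  then have IH: "H i y = H' i y" by simp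
  consider "Suc y + b \<le> i" | "a + c \<le> Suc y" "a + c \<le> y" | "i < Suc y + b" "y < a + c" by linarith
  then show ?case
  proof cases
    case 1
    then show ?thesis using assms(1,2,4) by (simp add: height_function.frozen_below)
  next
    case 2
    then show ?thesis using assms(1,2,4) Suc.prems by (simp add: height_function.frozen_above)
  next
    case 3
    let ?t = "Ver (int i) (int y)"
    have incr: "H i y \<le> H i (Suc y)" "H i (Suc y) \<le> Suc (H i y)"
      "H' i y \<le> H' i (Suc y)" "H' i (Suc y) \<le> Suc (H' i y)"
      using height_function.ver_edge[OF assms(1,4), of y] height_function.ver_edge[OF assms(2,4), of y] Suc.prems
      by auto
    have "H i (Suc y) \<noteq> H i y \<longleftrightarrow> H' i (Suc y) \<noteq> H' i y"
    proof (cases "0 < i \<and> i < a + b")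
      case True
      then have "\<forall>s\<in>cells_of ?t. in_hex a b c s" using 3 Suc.prems by auto
      then have "?t \<in> tiles_of_height a b c H \<longleftrightarrow> H i (Suc y) \<noteq> H i y"
        "?t \<in> tiles_of_height a b c H' \<longleftrightarrow> H' i (Suc y) \<noteq> H' i y"
        unfolding tiles_of_height_def by simp_all
      then show ?thesis using eq by blast
    next
      case False
      then consider "i = 0" | "i = a + b" using assms(4) by linarith
      then show ?thesis
        using Suc.prems height_function.left[OF assms(1)] height_function.left[OF assms(2)]
          height_function.right[OF assms(1)] height_function.right[OF assms(2)]
        by cases simp_all
    qed
    then show ?thesis using incr IH by linarith
  qed
qed

lemma bij_betw_gt_patterns_matchings:
  "bij_betw (\<lambda>p. tiles_of_height a b c (pattern_height p))
    (gt_patterns (a + b) (top_row a b c)) (matchings a b c)"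
  unfolding bij_betw_def
proof (intro conjI equalityI subsetI inj_onI)
  fix p q
  assume pq: "p \<in> gt_patterns (a + b) (top_row a b c)" "q \<in> gt_patterns (a + b) (top_row a b c)"
    "tiles_of_height a b c (pattern_height p) = tiles_of_height a b c (pattern_height q)"
  have eq: "pattern_height p i y = pattern_height q i y" if "i \<le> a + b" "y \<le> c + i" for i y
    using height_functions_eqI[OF pq(1,2)[THEN height_function_of_pattern] pq(3) that] .
  have "pattern_of_height (a + b) (pattern_height p) i k = pattern_of_height (a + b) (pattern_height q) i k" for i k
  proof (cases "i \<le> a + b \<and> k < i")
    case True
    let ?p = "pattern_of_height (a + b) (pattern_height p) i k"
    let ?q = "pattern_of_height (a + b) (pattern_height q) i k"
    have less: "?p < y \<longleftrightarrow> ?q < y" if "y \<le> c + i" for y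
      using True that eq[of i y]
        height_function.pattern_of_height_less_iff[OF height_function_of_pattern[OF pq(1)]]
        height_function.pattern_of_height_less_iff[OF height_function_of_pattern[OF pq(2)]] by simp
    have "?q < c + i"
      using pattern_entry_less[OF pq(2)] True by (simp add: pattern_of_pattern_height[OF pq(2)])
    then show ?thesis using less[of ?q] less[of "Suc ?q"] by simp
  qed (auto simp: pattern_of_height_def)
  then have "pattern_of_height (a + b) (pattern_height p) = pattern_of_height (a + b) (pattern_height q)"
    by (intro ext)
  then show "p = q"
    using pattern_of_pattern_height[OF pq(1)] pattern_of_pattern_height[OF pq(2)] by simp
next
  fix M assume "M \<in> (\<lambda>p. tiles_of_height a b c (pattern_height p)) ` gt_patterns (a + b) (top_row a b c)"
  then show "M \<in> matchings a b c"
    using height_function.tiles_of_height_in_matchings[OF height_function_of_pattern] by blast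
next
  fix M assume M: "M \<in> matchings a b c"
  interpret height_function a b c "height_of_matching a b c M" by (rule height_function_of_matching[OF M])
  let ?p = "pattern_of_height (a + b) (height_of_matching a b c M)"
  have "tiles_of_height a b c (pattern_height ?p) = M"
    using tiles_of_height_cong[of a b c "pattern_height ?p" "height_of_matching a b c M"]
      pattern_height_of_height tiles_of_height_of_matching[OF M] by simp
  then show "M \<in> (\<lambda>p. tiles_of_height a b c (pattern_height p)) ` gt_patterns (a + b) (top_row a b c)"
    using pattern_of_height_in_gt_patterns by blast
qed

lemma pattern_height_Suc:
  assumes "p \<in> gt_patterns (a + b) (top_row a b c)" "i \<le> a + b"
  shows "pattern_height p i (Suc j) = pattern_height p i j + of_bool (j \<in> p i ` {..<i})"
  unfolding pattern_height_def
  by (rule strict_mono_on_bounded_count_Suc[OF gt_patterns_strict_mono[OF assms(1) strict_mono_top_row assms(2)]])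

lemma Ver_in_tiles_of_pattern_iff:
  assumes p: "p \<in> gt_patterns (a + b) (top_row a b c)" and i: "0 < i" "i < a + b"
  shows "Ver (int i) (int j) \<in> tiles_of_height a b c (pattern_height p) \<longleftrightarrow>
    j \<in> p i ` {..<i} \<and> i \<le> j + b \<and> j < a + c"
proof -
  have "pattern_height p i (Suc j) \<noteq> pattern_height p i j \<longleftrightarrow> j \<in> p i ` {..<i}"
    using pattern_height_Suc[OF p, of i j] i by simp
  moreover have "(\<forall>s\<in>cells_of (Ver (int i) (int j)). in_hex a b c s) \<longleftrightarrow> i \<le> j + b \<and> j < a + c \<and> j < c + i"
    using i by auto
  moreover have "j < c + i" if "j \<in> p i ` {..<i}"
    using that pattern_entry_less[OF p, of i] i by auto
  ultimately show ?thesis unfolding tiles_of_height_def by auto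
qed

text \<open>The positions on line \<open>i\<close> that lie outside the hexagon.\<close>

definition frozen_positions :: "nat \<Rightarrow> nat \<Rightarrow> nat \<Rightarrow> nat \<Rightarrow> nat set" where
  "frozen_positions a b c i = {j. j + b < i} \<union> {a + c..<c + i}"

lemma frozen_positions_in_row:
  assumes p: "p \<in> gt_patterns (a + b) (top_row a b c)" and i: "i \<le> a + b"
  shows "frozen_positions a b c i \<subseteq> p i ` {..<i}"
proof
  interpret height_function a b c "pattern_height p" by (rule height_function_of_pattern[OF p])
  fix j assume "j \<in> frozen_positions a b c i"
  then consider "j + b < i" | "a + c \<le> j" "j < c + i" by (auto simp: frozen_positions_def)
  then have "pattern_height p i (Suc j) = Suc (pattern_height p i j)"
  proof cases
    case 1
    then show ?thesis using i frozen_below[of i j] frozen_below[of i "Suc j"] by simp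
  next
    case 2
    then show ?thesis using i frozen_above[of i j] frozen_above[of i "Suc j"] by simp
  qed
  then show "j \<in> p i ` {..<i}" using pattern_height_Suc[OF p i, of j] by (cases "j \<in> p i ` {..<i}") simp_all
qed

lemma sum_horizontal_in_column:
  fixes f :: "nat \<Rightarrow> real"
  assumes p: "p \<in> gt_patterns (a + b) (top_row a b c)" and i: "0 < i" "i < a + b"
  shows "(\<Sum>j<a + c. of_bool (Ver (int i) (int j) \<in> tiles_of_height a b c (pattern_height p)) * f j) =
    (\<Sum>k<i. f (p i k)) - (\<Sum>j\<in>frozen_positions a b c i. f j)"
proof -
  let ?R = "p i ` {..<i}" and ?Z = "frozen_positions a b c i"
  have "(\<Sum>j<a + c. of_bool (Ver (int i) (int j) \<in> tiles_of_height a b c (pattern_height p)) * f j) =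
      (\<Sum>j\<in>{j\<in>{..<a + c}. j \<in> ?R \<and> i \<le> j + b}. f j)"
    unfolding Ver_in_tiles_of_pattern_iff[OF p i] by (intro sum.mono_neutral_cong_right) auto
  also have "{j\<in>{..<a + c}. j \<in> ?R \<and> i \<le> j + b} = ?R - ?Z"
    using pattern_entry_less[OF p, of i] i by (auto simp: frozen_positions_def)
  also have "(\<Sum>j\<in>?R - ?Z. f j) = (\<Sum>j\<in>?R. f j) - (\<Sum>j\<in>?Z. f j)"
    using frozen_positions_in_row[OF p, of i] i by (intro sum_diff) auto
  also have "(\<Sum>j\<in>?R. f j) = (\<Sum>k<i. f (p i k))"
    using strict_mono_on_imp_inj_on[OF gt_patterns_strict_mono[OF p strict_mono_top_row, of i]] i
    by (simp add: sum.reindex)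
  finally show ?thesis .
qed

lemma sum_frozen_positions:
  fixes f :: "nat \<Rightarrow> nat \<Rightarrow> real"
  shows "(\<Sum>i\<in>{1..<a + b}. \<Sum>j\<in>frozen_positions a b c i. f i j) =
    (\<Sum>t<a. \<Sum>s<t. f (b + t) s) + (\<Sum>t<b. \<Sum>s<t. f (a + t) (a + c + s))"
proof -
  have "(\<Sum>j\<in>frozen_positions a b c i. f i j) = (\<Sum>s<i - b. f i s) + (\<Sum>s<i - a. f i (a + c + s))"
    if i: "i < a + b" for i
  proof -
    have "(\<Sum>j\<in>frozen_positions a b c i. f i j) = (\<Sum>j\<in>{..<i - b}. f i j) + (\<Sum>j\<in>{a + c..<c + i}. f i j)"
      using i unfolding frozen_positions_def
      by (subst sum.union_disjoint[symmetric]) (auto intro!: arg_cong2[where f=sum])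
    also have "(\<Sum>j\<in>{a + c..<c + i}. f i j) = (\<Sum>s<i - a. f i (a + c + s))"
      by (rule sum.reindex_bij_witness[of _ "\<lambda>s. a + c + s" "\<lambda>j. j - (a + c)"]) auto
    finally show ?thesis .
  qed
  then have "(\<Sum>i\<in>{1..<a + b}. \<Sum>j\<in>frozen_positions a b c i. f i j) =
      (\<Sum>i\<in>{1..<a + b}. \<Sum>s<i - b. f i s) + (\<Sum>i\<in>{1..<a + b}. \<Sum>s<i - a. f i (a + c + s))"
    by (simp add: sum.distrib)
  also have "(\<Sum>i\<in>{1..<a + b}. \<Sum>s<i - b. f i s) = (\<Sum>i\<in>{b..<a + b}. \<Sum>s<i - b. f i s)"
    by (rule sum.mono_neutral_cong) auto
  also have "\<dots> = (\<Sum>t<a. \<Sum>s<t. f (b + t) s)"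
    by (rule sum.reindex_bij_witness[of _ "\<lambda>t. b + t" "\<lambda>i. i - b"]) auto
  also have "(\<Sum>i\<in>{1..<a + b}. \<Sum>s<i - a. f i (a + c + s)) = (\<Sum>i\<in>{a..<a + b}. \<Sum>s<i - a. f i (a + c + s))"
    by (rule sum.mono_neutral_cong) auto
  also have "\<dots> = (\<Sum>t<b. \<Sum>s<t. f (a + t) (a + c + s))"
    by (rule sum.reindex_bij_witness[of _ "\<lambda>t. a + t" "\<lambda>i. i - a"]) auto
  finally show ?thesis .
qed

lemma lozenge_prob_eq:
  assumes "a > 0" "b > 0" "c > 0"
  defines "G \<equiv> gt_patterns (a + b) (top_row a b c)"
  shows "lozenge_prob a b c x y =
    (\<Sum>p\<in>G. of_bool (Ver x y \<in> tiles_of_height a b c (pattern_height p))) / real (card G)"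
proof -
  let ?T = "\<lambda>p. lozenge_of ` tiles_of_height a b c (pattern_height p)"
  have bij: "bij_betw ?T G (lozenge_tilings a b c)"
    using bij_betw_trans[OF bij_betw_gt_patterns_matchings bij_betw_matchings_tilings[OF assms(1-3)]]
    by (simp add: G_def o_def)
  have "horizontal_lozenge x y \<in> ?T p \<longleftrightarrow> Ver x y \<in> tiles_of_height a b c (pattern_height p)" for p
    unfolding horizontal_lozenge_eq using inj_lozenge_of by (simp add: inj_image_mem_iff)
  then have img: "?T ` {p \<in> G. Ver x y \<in> tiles_of_height a b c (pattern_height p)} =
      {T \<in> lozenge_tilings a b c. horizontal_lozenge x y \<in> T}"
    unfolding bij_betw_imp_surj_on[OF bij, symmetric] by blast
  have inj: "inj_on ?T {p \<in> G. Ver x y \<in> tiles_of_height a b c (pattern_height p)}"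
    using bij by (auto simp: bij_betw_def intro: inj_on_subset)
  have "card {T \<in> lozenge_tilings a b c. horizontal_lozenge x y \<in> T} =
      card {p \<in> G. Ver x y \<in> tiles_of_height a b c (pattern_height p)}"
    by (simp only: img[symmetric] card_image[OF inj])
  moreover have "finite G" by (simp add: G_def finite_gt_patterns)
  ultimately show ?thesis
    by (simp add: lozenge_prob_def bij_betw_same_card[OF bij, symmetric] of_bool_def sum.If_cases Int_def)
qed

text \<open>By linearity of expectation, the sum is the expected sum over all rows of the pattern, less the contribution of
  the added positions, which are the same in all patterns; these fill two triangular corners.\<close>

lemma sum_lozenge_prob:
  fixes F :: "int \<Rightarrow> int \<Rightarrow> real"
  assumes "a > 0" "b > 0" "c > 0"
  defines "G \<equiv> gt_patterns (a + b) (top_row a b c)"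
  shows "(\<Sum>x = 1..int (a + b) - 1. \<Sum>y = 0..int (a + c) - 1. lozenge_prob a b c x y * F x y) =
    (\<Sum>i\<in>{1..<a + b}. (\<Sum>p\<in>G. \<Sum>k<i. F (int i) (int (p i k))) / real (card G)) -
    ((\<Sum>t<a. \<Sum>s<t. F (int (b + t)) (int s)) + (\<Sum>t<b. \<Sum>s<t. F (int (a + t)) (int (a + c + s))))"
proof -
  let ?V = "\<lambda>p i j. of_bool (Ver (int i) (int j) \<in> tiles_of_height a b c (pattern_height p)) :: real"
  have G: "finite G" "G \<noteq> {}"
    unfolding G_def by (rule finite_gt_patterns, rule gt_patterns_nonempty[OF strict_mono_top_row])
  then have card: "real (card G) \<noteq> 0" by simp
  have "(\<Sum>y = 0..int (a + c) - 1. lozenge_prob a b c (int i) y * F (int i) y) =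
      (\<Sum>p\<in>G. \<Sum>k<i. F (int i) (int (p i k))) / real (card G) - (\<Sum>j\<in>frozen_positions a b c i. F (int i) (int j))"
    if i: "0 < i" "i < a + b" for i
  proof -
    have "(\<Sum>y = 0..int (a + c) - 1. lozenge_prob a b c (int i) y * F (int i) y) =
        (\<Sum>j<a + c. lozenge_prob a b c (int i) (int j) * F (int i) (int j))"
      by (rule sum.reindex_bij_witness[of _ int nat]) auto
    also have "\<dots> = (\<Sum>j<a + c. (\<Sum>p\<in>G. ?V p i j * F (int i) (int j)) / real (card G))"
      unfolding lozenge_prob_eq[OF assms(1-3)] G_def by (simp add: sum_distrib_right)
    also have "\<dots> = (\<Sum>p\<in>G. \<Sum>j<a + c. ?V p i j * F (int i) (int j)) / real (card G)"
      by (subst sum.swap) (simp add: sum_divide_distrib)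
    also have "\<dots> = (\<Sum>p\<in>G. (\<Sum>k<i. F (int i) (int (p i k))) - (\<Sum>j\<in>frozen_positions a b c i. F (int i) (int j))) / real (card G)"
      using sum_horizontal_in_column[OF _ i] by (simp add: G_def)
    also have "\<dots> = (\<Sum>p\<in>G. \<Sum>k<i. F (int i) (int (p i k))) / real (card G) - (\<Sum>j\<in>frozen_positions a b c i. F (int i) (int j))"
      using card by (simp add: sum_subtractf diff_divide_distrib)
    finally show ?thesis .
  qed
  then have "(\<Sum>i\<in>{1..<a + b}. \<Sum>y = 0..int (a + c) - 1. lozenge_prob a b c (int i) y * F (int i) y) =
      (\<Sum>i\<in>{1..<a + b}. (\<Sum>p\<in>G. \<Sum>k<i. F (int i) (int (p i k))) / real (card G)) -
      (\<Sum>i\<in>{1..<a + b}. \<Sum>j\<in>frozen_positions a b c i. F (int i) (int j))"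
    by (simp add: sum_subtractf)
  moreover have "(\<Sum>x = 1..int (a + b) - 1. \<Sum>y = 0..int (a + c) - 1. lozenge_prob a b c x y * F x y) =
      (\<Sum>i\<in>{1..<a + b}. \<Sum>y = 0..int (a + c) - 1. lozenge_prob a b c (int i) y * F (int i) y)"
    by (rule sum.reindex_bij_witness[of _ int nat]) auto
  ultimately show ?thesis unfolding sum_frozen_positions by simp
qed

section \<open>Evaluation of the moments\<close>

lemma top_row_power_sums:
  "(\<Sum>k<a + b. real (top_row a b c k)) = real (a + b) * (real (a + b) - 1) / 2 + real b * real c"
  "(\<Sum>k<a + b. (real (top_row a b c k))\<^sup>2) = (\<Sum>k<a + b. (real k)\<^sup>2) +
    real b * real c * (2 * real a + real b - 1 + real c)"
proof -
  have split: "(\<Sum>k<a + b. g k) = (\<Sum>k<a. g k) + (\<Sum>k<b. g (a + k))" for g :: "nat \<Rightarrow> real"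
    by (induction b) (simp_all add: algebra_simps)
  have low: "top_row a b c k = k" if "k < a" for k using that by (simp add: top_row_def)
  have high: "top_row a b c (a + k) = a + k + c" if "k < b" for k using that by (simp add: top_row_def)
  have "(\<Sum>k<a + b. real (top_row a b c k)) = (\<Sum>k<a. real k) + (\<Sum>k<b. real (a + k) + real c)"
    unfolding split by (simp add: low high)
  also have "\<dots> = (\<Sum>k<a + b. real k) + real b * real c"
    unfolding split[of real] by (simp add: sum.distrib)
  finally show "(\<Sum>k<a + b. real (top_row a b c k)) = real (a + b) * (real (a + b) - 1) / 2 + real b * real c"
    by (simp only: sum_power_1)
  have square: "(real (top_row a b c (a + k)))\<^sup>2 =
      (real (a + k))\<^sup>2 + (real c * (2 * real a + real c) + 2 * real c * real k)" if "k < b" for k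
    unfolding high[OF that] by (simp add: power2_eq_square algebra_simps)
  have "(\<Sum>k<a + b. (real (top_row a b c k))\<^sup>2) =
      (\<Sum>k<a. (real k)\<^sup>2) + (\<Sum>k<b. (real (a + k))\<^sup>2 + (real c * (2 * real a + real c) + 2 * real c * real k))"
    unfolding split by (intro arg_cong2[where f="(+)"] sum.cong refl) (simp_all only: low square lessThan_iff)
  also have "\<dots> = (\<Sum>k<a + b. (real k)\<^sup>2) + (\<Sum>k<b. real c * (2 * real a + real c) + 2 * real c * real k)"
    unfolding split[of "\<lambda>k. (real k)\<^sup>2"] by (simp add: sum.distrib)
  also have "(\<Sum>k<b. real c * (2 * real a + real c) + 2 * real c * real k) =
      real b * real c * (2 * real a + real b - 1 + real c)"
    unfolding sum.distrib sum_distrib_left[symmetric] sum_power_1 by (simp add: field_simps)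
  finally show "(\<Sum>k<a + b. (real (top_row a b c k))\<^sup>2) = (\<Sum>k<a + b. (real k)\<^sup>2) +
    real b * real c * (2 * real a + real b - 1 + real c)" .
qed

text \<open>Three linear equations for three unknowns: the first two power sums of the top row, and the square of the
  first one, whose expansion is obtained by multiplying by it twice.\<close>

lemma top_row_alternants:
  fixes a b c :: nat
  assumes "a > 0" "b > 0"
  defines "n \<equiv> real (a + b)" and "D \<equiv> vandermonde (a + b) (top_row a b c)"
  shows "n * alternant_1 (a + b) (top_row a b c) = real b * real c * D"
    and "n * (n + 1) * alternant_2 (a + b) (top_row a b c) =
      real b * real c * (real b + 1) * (real c - 1) / 2 * D"
    and "n * (n - 1) * alternant_11 (a + b) (top_row a b c) =
      real b * real c * (real b - 1) * (real c + 1) / 2 * D"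
proof -
  define A1 A2 A11 where "A1 = alternant_1 (a + b) (top_row a b c)"
    and "A2 = alternant_2 (a + b) (top_row a b c)" and "A11 = alternant_11 (a + b) (top_row a b c)"
  \<comment> \<open>The excess of the sum of the top row over \<open>0 + 1 + ... + (n - 1)\<close>.\<close>
  define q where "q = real b * real c"
  have "(n * (n - 1) / 2 + q) * D = n * A1 + n * (n - 1) / 2 * D"
    using power_sum_1_vandermonde[of "top_row a b c" "a + b"]
    unfolding top_row_power_sums n_def D_def A1_def q_def by simp
  then have 1: "n * A1 = q * D" by (simp add: algebra_simps)
  have "((\<Sum>k<a + b. (real k)\<^sup>2) + q * (2 * real a + real b - 1 + real c)) * D =
      n * (n + 1) * A2 - n * (n - 1) * A11 + n * (2 * n - 1) * A1 + (\<Sum>k<a + b. (real k)\<^sup>2) * D"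
    using power_sum_2_vandermonde[of "a + b" "top_row a b c"] assms(1)
    unfolding top_row_power_sums n_def D_def A1_def A2_def A11_def q_def by simp
  then have "n * (n + 1) * A2 - n * (n - 1) * A11 = q * (2 * real a + real b - 1 + real c) * D - (2 * n - 1) * (n * A1)"
    by (simp add: algebra_simps)
  then have 2: "n * (n + 1) * A2 - n * (n - 1) * A11 = (real c - real b) * (q * D)"
    unfolding 1 by (simp add: n_def algebra_simps)
  have "(n * (n - 1) / 2 + q) * A1 = (n + 1) * A2 + (n - 1) * A11 + (n + (n - 1) * (n - 2) / 2) * A1"
    using power_sum_1_alternant_1[of "a + b" "top_row a b c"] assms(1,2)
    unfolding top_row_power_sums n_def D_def A1_def A2_def A11_def q_def by (simp add: of_nat_diff)
  moreover have "n * (n - 1) / 2 + q = (q - 1) + (n + (n - 1) * (n - 2) / 2)" by (simp add: field_simps)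
  ultimately have "(q - 1) * A1 = (n + 1) * A2 + (n - 1) * A11"
    by (simp only: distrib_right[of "q - 1"] add_right_cancel)
  then have "n * ((q - 1) * A1) = n * ((n + 1) * A2 + (n - 1) * A11)" by (simp only:)
  then have "n * (n + 1) * A2 + n * (n - 1) * A11 = (q - 1) * (n * A1)"
    by (simp only: distrib_left mult_ac)
  then have 3: "n * (n + 1) * A2 + n * (n - 1) * A11 = (q - 1) * (q * D)" by (simp only: 1)
  have half: "x = (u + v) / 2" "y = (v - u) / 2" if "x - y = u" "x + y = v" for x y u v :: real
    using that by simp_all
  show "n * alternant_1 (a + b) (top_row a b c) = real b * real c * D"
    using 1 by (simp only: A1_def q_def)
  show "n * (n + 1) * alternant_2 (a + b) (top_row a b c) = real b * real c * (real b + 1) * (real c - 1) / 2 * D"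
    unfolding A2_def[symmetric] half(1)[OF 2 3] by (simp add: q_def algebra_simps)
  show "n * (n - 1) * alternant_11 (a + b) (top_row a b c) = real b * real c * (real b - 1) * (real c + 1) / 2 * D"
    unfolding A11_def[symmetric] half(2)[OF 2 3] by (simp add: q_def algebra_simps)
qed

lemma sum_from_1: "g 0 = 0 \<Longrightarrow> (\<Sum>i\<in>{1..<n}. g i) = (\<Sum>i<n. g i)" for g :: "nat \<Rightarrow> real"
  by (rule sum.mono_neutral_left) (auto simp: not_le)

lemma sum_linear_weight_square:
  "(\<Sum>t<n. real t * (real t + q)\<^sup>2) =
    (real n * (real n - 1))\<^sup>2 / 4 + q * (real n * (real n - 1) * (2 * real n - 1)) / 3 + q\<^sup>2 * (real n * (real n - 1)) / 2"
proof -
  have "(\<Sum>t<n. real t * (real t + q)\<^sup>2) = (\<Sum>t<n. real t ^ 3 + 2 * q * (real t)\<^sup>2 + q\<^sup>2 * real t)"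
    by (rule sum.cong) (simp_all add: power2_eq_square power3_eq_cube algebra_simps)
  then show ?thesis
    unfolding sum.distrib sum_distrib_left[symmetric] sum_power_1 sum_power_2 sum_power_3 by simp
qed

text \<open>The numbers \<open>2 s - t + 1\<close> with \<open>s < t\<close> are symmetric about 0, so there is no term linear in \<open>r\<close>.\<close>

lemma sum_triangle_square:
  "(\<Sum>t<n. \<Sum>s<t. (2 * real s - real t + 1 + r)\<^sup>2) =
    (real n * (real n - 1))\<^sup>2 / 12 + (r\<^sup>2 - 1 / 3) * (real n * (real n - 1) / 2)"
proof -
  have inner: "(\<Sum>s<t. (2 * real s - real t + 1 + r)\<^sup>2) = real t ^ 3 / 3 + (r\<^sup>2 - 1 / 3) * real t" for t
  proof -
    have "(\<Sum>s<t. (2 * real s - real t + 1 + r)\<^sup>2) =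
        (\<Sum>s<t. 4 * (real s)\<^sup>2 + 4 * (1 + r - real t) * real s + (1 + r - real t)\<^sup>2)"
      by (rule sum.cong) (simp_all add: power2_eq_square algebra_simps)
    also have "\<dots> = 4 * (real t * (real t - 1) * (2 * real t - 1) / 6) + 4 * (1 + r - real t) * (real t * (real t - 1) / 2)
        + real t * (1 + r - real t)\<^sup>2"
      unfolding sum.distrib sum_distrib_left[symmetric] sum_power_1 sum_power_2 by simp
    finally show ?thesis by (simp add: power2_eq_square power3_eq_cube field_simps)
  qed
  show ?thesis
    unfolding inner sum.distrib sum_distrib_left[symmetric] sum_divide_distrib[symmetric] sum_power_1 sum_power_3
    by simp
qed

definition row_mean_1 :: "nat \<Rightarrow> nat \<Rightarrow> nat \<Rightarrow> nat \<Rightarrow> real" where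
  "row_mean_1 a b c i = (\<Sum>p\<in>gt_patterns (a + b) (top_row a b c). \<Sum>k<i. real (p i k)) /
     real (card (gt_patterns (a + b) (top_row a b c)))"

definition row_mean_2 :: "nat \<Rightarrow> nat \<Rightarrow> nat \<Rightarrow> nat \<Rightarrow> real" where
  "row_mean_2 a b c i = (\<Sum>p\<in>gt_patterns (a + b) (top_row a b c). \<Sum>k<i. (real (p i k))\<^sup>2) /
     real (card (gt_patterns (a + b) (top_row a b c)))"

lemma card_gt_patterns_top_row_pos: "real (card (gt_patterns (a + b) (top_row a b c))) > 0"
  using gt_patterns_nonempty[OF strict_mono_top_row] by (simp add: card_gt_0_iff finite_gt_patterns)

lemma row_mean_quadratic:
  "(\<Sum>p\<in>gt_patterns (a + b) (top_row a b c). \<Sum>k<i. (2 * real (p i k) + r)\<^sup>2) /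
     real (card (gt_patterns (a + b) (top_row a b c))) =
   4 * row_mean_2 a b c i + 4 * r * row_mean_1 a b c i + real i * r\<^sup>2"
proof -
  let ?G = "gt_patterns (a + b) (top_row a b c)"
  have "(\<Sum>p\<in>?G. \<Sum>k<i. (2 * real (p i k) + r)\<^sup>2) =
      (\<Sum>p\<in>?G. \<Sum>k<i. 4 * (real (p i k))\<^sup>2 + 4 * r * real (p i k) + r\<^sup>2)"
    by (intro sum.cong refl) (simp add: power2_eq_square algebra_simps)
  also have "\<dots> = 4 * (\<Sum>p\<in>?G. \<Sum>k<i. (real (p i k))\<^sup>2) + 4 * r * (\<Sum>p\<in>?G. \<Sum>k<i. real (p i k))
      + real (card ?G) * (real i * r\<^sup>2)"
    unfolding sum.distrib sum_distrib_left[symmetric] by simp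
  finally show ?thesis
    using card_gt_patterns_top_row_pos[of a b c] by (simp add: row_mean_1_def row_mean_2_def add_divide_distrib)
qed

text \<open>The constants are the common expectations of the three normalized alternants, which are evaluated on the
  top row. They are characterized without division, because the sum over all rows of the coefficient of each constant
  contains the factor that multiplies the constant here.\<close>

lemma row_means:
  fixes a b c :: nat
  assumes "a > 0" "b > 0"
  obtains \<alpha> \<beta> \<gamma> where
    "real (a + b) * (real (a + b) + 1) * \<alpha> = real b * real c * (real b + 1) * (real c - 1) / 2"
    "real (a + b) * (real (a + b) - 1) * \<beta> = real b * real c * (real b - 1) * (real c + 1) / 2"
    "real (a + b) * \<gamma> = real b * real c"
    "\<And>i. \<lbrakk>1 \<le> i; i \<le> a + b\<rbrakk> \<Longrightarrow> row_mean_1 a b c i = real i * \<gamma> + real i * (real i - 1) / 2"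
    "\<And>i. \<lbrakk>1 \<le> i; i \<le> a + b\<rbrakk> \<Longrightarrow> row_mean_2 a b c i = real i * (real i + 1) * \<alpha> - real i * (real i - 1) * \<beta>
      + real i * (2 * real i - 1) * \<gamma> + real i * (real i - 1) * (2 * real i - 1) / 6"
proof -
  let ?l = "top_row a b c"
  define D where "D = vandermonde (a + b) ?l"
  have card: "real (card (gt_patterns (a + b) ?l)) = D"
    unfolding D_def by (rule card_gt_patterns[OF strict_mono_top_row])
  then have D: "D > 0" using card_gt_patterns_top_row_pos[of a b c] by simp
  show thesis
  proof (rule that)
    show "real (a + b) * (real (a + b) + 1) * (alternant_2 (a + b) ?l / D) = real b * real c * (real b + 1) * (real c - 1) / 2"
      using top_row_alternants(2)[OF assms, of c] D by (simp add: D_def[symmetric] field_simps)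
    show "real (a + b) * (real (a + b) - 1) * (alternant_11 (a + b) ?l / D) = real b * real c * (real b - 1) * (real c + 1) / 2"
      using top_row_alternants(3)[OF assms, of c] D by (simp add: D_def[symmetric] field_simps)
    show "real (a + b) * (alternant_1 (a + b) ?l / D) = real b * real c"
      using top_row_alternants(1)[OF assms, of c] D by (simp add: D_def[symmetric] field_simps)
    fix i assume i: "1 \<le> i" "i \<le> a + b"
    show "row_mean_1 a b c i = real i * (alternant_1 (a + b) ?l / D) + real i * (real i - 1) / 2"
      unfolding row_mean_1_def card sum_gt_patterns_power_sum_1[OF i strict_mono_top_row] D_def[symmetric]
      using D by (simp add: add_divide_distrib)
    show "row_mean_2 a b c i = real i * (real i + 1) * (alternant_2 (a + b) ?l / D)
      - real i * (real i - 1) * (alternant_11 (a + b) ?l / D)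
      + real i * (2 * real i - 1) * (alternant_1 (a + b) ?l / D) + real i * (real i - 1) * (2 * real i - 1) / 6"
      unfolding row_mean_2_def card sum_gt_patterns_power_sum_2[OF i strict_mono_top_row] D_def[symmetric] sum_power_2
      using D by (simp add: add_divide_distrib diff_divide_distrib)
  qed
qed

text \<open>The summand is the expectation of the sum of \<open>(2 j - i + \<kappa>)\<^sup>2\<close> over the
  positions \<open>j\<close> on line \<open>i\<close>.\<close>

lemma sum_row_means:
  fixes a b c :: nat and \<kappa> :: real
  assumes "a > 0" "b > 0"
  defines "n \<equiv> real a + real b" and "q \<equiv> real b * real c"
  shows "(\<Sum>i\<in>{1..<a + b}. 4 * row_mean_2 a b c i + 4 * (\<kappa> - real i) * row_mean_1 a b c i + real i * (\<kappa> - real i)\<^sup>2) =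
    4 / 3 * (n - 1) * (q * (real b + 1) * (real c - 1) / 2) - 4 / 3 * (n - 2) * (q * (real b - 1) * (real c + 1) / 2)
    + q * (n - 1) * ((4 * n - 8) / 3 + 2 * \<kappa>) + (n * (n - 1))\<^sup>2 / 12 + (\<kappa>\<^sup>2 - 2 * \<kappa> + 2 / 3) * (n * (n - 1)) / 2"
proof -
  obtain \<alpha> \<beta> \<gamma> where
    abc: "n * (n + 1) * \<alpha> = q * (real b + 1) * (real c - 1) / 2"
      "n * (n - 1) * \<beta> = q * (real b - 1) * (real c + 1) / 2" "n * \<gamma> = q"
    and means: "\<And>i. \<lbrakk>1 \<le> i; i \<le> a + b\<rbrakk> \<Longrightarrow> row_mean_1 a b c i = real i * \<gamma> + real i * (real i - 1) / 2"
      "\<And>i. \<lbrakk>1 \<le> i; i \<le> a + b\<rbrakk> \<Longrightarrow> row_mean_2 a b c i = real i * (real i + 1) * \<alpha> - real i * (real i - 1) * \<beta>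
      + real i * (2 * real i - 1) * \<gamma> + real i * (real i - 1) * (2 * real i - 1) / 6"
    using row_means[OF assms(1,2), of c] unfolding of_nat_add n_def q_def by metis
  define u v where "u = 4 * (\<alpha> - \<beta> + \<gamma>)" and "v = 4 * \<alpha> + 4 * \<beta> - 4 * \<gamma> + 4 * \<kappa> * \<gamma> + \<kappa>\<^sup>2 - 2 * \<kappa> + 2 / 3"
  have "(\<Sum>i\<in>{1..<a + b}. 4 * row_mean_2 a b c i + 4 * (\<kappa> - real i) * row_mean_1 a b c i + real i * (\<kappa> - real i)\<^sup>2) =
      (\<Sum>i\<in>{1..<a + b}. real i ^ 3 / 3 + u * (real i)\<^sup>2 + v * real i)"
    by (intro sum.cong refl) (simp add: means u_def v_def power2_eq_square power3_eq_cube field_simps)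
  also have "\<dots> = (\<Sum>i<a + b. real i ^ 3 / 3 + u * (real i)\<^sup>2 + v * real i)"
    by (rule sum_from_1) simp
  also have "\<dots> = (n * (n - 1))\<^sup>2 / 12 + u * (n * (n - 1) * (2 * n - 1) / 6) + v * (n * (n - 1) / 2)"
    unfolding sum.distrib sum_distrib_left[symmetric] sum_divide_distrib[symmetric] sum_power_1 sum_power_2 sum_power_3
    by (simp add: n_def)
  also have "\<dots> = 4 / 3 * (n - 1) * (n * (n + 1) * \<alpha>) - 4 / 3 * (n - 2) * (n * (n - 1) * \<beta>)
      + (n * \<gamma>) * (n - 1) * ((4 * n - 8) / 3 + 2 * \<kappa>) + (n * (n - 1))\<^sup>2 / 12 + (\<kappa>\<^sup>2 - 2 * \<kappa> + 2 / 3) * (n * (n - 1)) / 2"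
    unfolding u_def v_def by (simp add: field_simps)
  finally show ?thesis by (simp only: abc)
qed

theorem theorem1:
  fixes a b c :: nat
  assumes "a > 0" and "b > 0" and "c > 0"
  shows "(\<Sum>x = 1..int (a + b) - 1. \<Sum>y = 0..int (a + c) - 1.
            lozenge_prob a b c x y * (real_of_int x - (real a + real b) / 2)\<^sup>2)
         = 1 / 12 * real a * real b * ((real a)\<^sup>2 + (real b)\<^sup>2 - 2)
    \<and> (\<Sum>y = 0..int (a + c) - 1. \<Sum>x = 1..int (a + b) - 1.
            lozenge_prob a b c x y *
              (2 * (real_of_int y - (real a + real c - 1) / 2)
                - (real_of_int x - (real a + real b) / 2))\<^sup>2)
         = 1 / 12 * real a * real b *
             ((real a)\<^sup>2 + (real b)\<^sup>2 - 2 + 4 * (real c)\<^sup>2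
               + 4 * real a * real c + 4 * real b * real c)"
proof
  define h where "h = (real a + real b) / 2"
  have "(\<Sum>x = 1..int (a + b) - 1. \<Sum>y = 0..int (a + c) - 1. lozenge_prob a b c x y * (real_of_int x - h)\<^sup>2) =
      (\<Sum>i\<in>{1..<a + b}. real i * (real i + (- h))\<^sup>2)
      - ((\<Sum>t<a. real t * (real t + (real b - h))\<^sup>2) + (\<Sum>t<b. real t * (real t + (real a - h))\<^sup>2))"
    unfolding sum_lozenge_prob[OF assms] using card_gt_patterns_top_row_pos[of a b c]
    by (simp add: algebra_simps)
  also have "\<dots> = 1 / 12 * real a * real b * ((real a)\<^sup>2 + (real b)\<^sup>2 - 2)"
    by (subst sum_from_1, simp, unfold sum_linear_weight_square, simp add: h_def power2_eq_square field_simps)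
  finally show "(\<Sum>x = 1..int (a + b) - 1. \<Sum>y = 0..int (a + c) - 1.
      lozenge_prob a b c x y * (real_of_int x - (real a + real b) / 2)\<^sup>2) =
    1 / 12 * real a * real b * ((real a)\<^sup>2 + (real b)\<^sup>2 - 2)"
    unfolding h_def .
next
  \<comment> \<open>With this shift the vertical offset of the lozenge \<open>(i, j)\<close> is \<open>2 j - i + \<kappa>\<close>. The two corners outside the
    hexagon are mirror images in its centre, hence the shifts \<open>- r\<close> and \<open>r\<close>.\<close>
  define \<kappa> where "\<kappa> = (real b - real a) / 2 - real c + 1"
  define r where "r = (real a + real b) / 2 + real c"
  let ?F = "\<lambda>x y. (2 * (real_of_int y - (real a + real c - 1) / 2) - (real_of_int x - (real a + real b) / 2))\<^sup>2"
  have row: "?F (int i) (int y) = (2 * real y + (\<kappa> - real i))\<^sup>2" for i y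
    by (rule arg_cong[where f="\<lambda>z. z\<^sup>2"]) (simp add: \<kappa>_def field_simps)
  have low: "2 * real s + (\<kappa> - real (b + t)) = 2 * real s - real t + 1 + (- r)" for s t
    by (simp add: \<kappa>_def r_def field_simps)
  have high: "2 * real (a + c + s) + (\<kappa> - real (a + t)) = 2 * real s - real t + 1 + r" for s t
    by (simp add: \<kappa>_def r_def field_simps)
  have "(\<Sum>y = 0..int (a + c) - 1. \<Sum>x = 1..int (a + b) - 1. lozenge_prob a b c x y * ?F x y) =
      (\<Sum>x = 1..int (a + b) - 1. \<Sum>y = 0..int (a + c) - 1. lozenge_prob a b c x y * ?F x y)"
    by (rule sum.swap)
  also have "\<dots> = (\<Sum>i\<in>{1..<a + b}. 4 * row_mean_2 a b c i + 4 * (\<kappa> - real i) * row_mean_1 a b c i + real i * (\<kappa> - real i)\<^sup>2)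
      - ((\<Sum>t<a. \<Sum>s<t. (2 * real s - real t + 1 + (- r))\<^sup>2) + (\<Sum>t<b. \<Sum>s<t. (2 * real s - real t + 1 + r)\<^sup>2))"
    unfolding sum_lozenge_prob[OF assms] row low high row_mean_quadratic ..
  also have "\<dots> = 1 / 12 * real a * real b * ((real a)\<^sup>2 + (real b)\<^sup>2 - 2 + 4 * (real c)\<^sup>2
      + 4 * real a * real c + 4 * real b * real c)"
    unfolding sum_row_means[OF assms(1,2)] sum_triangle_square
    by (simp add: \<kappa>_def r_def power2_eq_square field_simps)
  finally show "(\<Sum>y = 0..int (a + c) - 1. \<Sum>x = 1..int (a + b) - 1. lozenge_prob a b c x y * ?F x y) =
    1 / 12 * real a * real b * ((real a)\<^sup>2 + (real b)\<^sup>2 - 2 + 4 * (real c)\<^sup>2 + 4 * real a * real c + 4 * real b * real c)" .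
qed

end
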